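(* There exists a universal and ultrahomogeneous $1$-Lipschitz retraction $R:\mathbb{U}\to F_{\mathbb{U}}\subsetneq\mathbb{U}$, where $F_{\mathbb{U}}$ is again isometric to $\mathbb{U}$. Precisely, $(\mathbb{U},R,F_{\mathbb{U}})$ is uniquely characterized by the following property. (Ultrahomogeneity) Let $A_1,A_2\subseteq\mathbb{U}$ be two finite subsets that are isomorphic, i.e. there exists an isometry $\iota:A_1\to A_2$ such that for every $x\in A_1$ we have $\iota(R(x))=R(\iota(x))$ (in particular, $R(x)\in A_1$), and for every $x\in A_1$ we have $\mathrm{dist}(x,F_{\mathbb{U}})=\mathrm{dist}(\iota(x),F_{\mathbb{U}})$. Then $\iota$ extends to an autoisometry of $\mathbb{U}$ that still commutes with the retraction $R$ and preserves the distance from $F_{\mathbb{U}}$. As a consequence, $(\mathbb{U},R,F_{\mathbb{U}})$ has the following property. (Universality) Let $X$ be any Polish metric space equipped with a $1$-Lipschitz retraction $Q:X\to F_X$. Then there exists an isometric embedding $\iota:X\to\mathbb{U}$ such that for every $x\in X$ we have $R(\iota(x))=\iota(Q(x))$ and $\mathrm{dist}(x,F_X)=\mathrm{dist}(\iota(x),F_{\mathbb{U}})$.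
   Context: A Polish metric space is a separable complete metric space. $\mathbb{U}$ denotes the Urysohn universal metric space: the (unique up to isometry) separable complete metric space such that for every finite (possibly empty) subset $M\subseteq\mathbb{U}$ and every finite metric space $M'\supseteq M$ extending $M$, the inclusion $M\hookrightarrow\mathbb{U}$ extends to an isometric embedding $M'\hookrightarrow\mathbb{U}$. A $1$-Lipschitz retraction $Q:X\to F$ onto a subset $F\subseteq X$ is a $1$-Lipschitz map with $Q(X)=F$ and $Q(x)=x$ for all $x\in F$. $\mathrm{dist}(x,F)=\inf_{y\in F}d(x,y)$. An autoisometry of $\mathbb{U}$ is a surjective isometry $\mathbb{U}\to\mathbb{U}$.
   Formalization: Uniqueness is claimed among retractions that are both universal and ultrahomogeneous, since ultrahomogeneity alone does not determine the triple (bounded-distance examples); Universality is stated for Polish spaces X carried by subsets of the reals, which represent all up to isometry. *)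

theory Defs
  imports "HOL-Analysis.Analysis"
begin

section \<open>Metric notions\<close>

definition polish_metric :: "'a metric \<Rightarrow> bool" where
  "polish_metric m \<longleftrightarrow> mcomplete_of m \<and> separable_space (mtopology_of m)"

definition isometric_embedding :: "'a metric \<Rightarrow> 'b metric \<Rightarrow> ('a \<Rightarrow> 'b) \<Rightarrow> bool" where
  "isometric_embedding m m' f \<longleftrightarrow>
     f \<in> mspace m \<rightarrow> mspace m' \<and>
     (\<forall>x\<in>mspace m. \<forall>y\<in>mspace m. mdist m' (f x) (f y) = mdist m x y)"

definition surjective_isometry :: "'a metric \<Rightarrow> 'b metric \<Rightarrow> ('a \<Rightarrow> 'b) \<Rightarrow> bool" where
  "surjective_isometry m m' f \<longleftrightarrow> isometric_embedding m m' f \<and> f ` mspace m = mspace m'"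

definition dist_to_set :: "'a metric \<Rightarrow> 'a \<Rightarrow> 'a set \<Rightarrow> real" where
  "dist_to_set m x F = (INF y\<in>F. mdist m x y)"

text \<open>A finite metric space extending a finite subset \<open>M\<close> of \<open>U\<close> is a finite metric space \<open>M'\<close>
  together with an isometric embedding \<open>j\<close> of \<open>M\<close> into it.  Every finite metric space is isometric
  to one whose points are natural numbers, so it suffices to let \<open>M'\<close> range over those.
  The case \<open>M = {}\<close> is included.\<close>

definition urysohn_space :: "'a metric \<Rightarrow> bool" where
  "urysohn_space U \<longleftrightarrow>
     polish_metric U \<and>
     (\<forall>M (M' :: nat metric) j.
        finite M \<and> M \<subseteq> mspace U \<and> finite (mspace M') \<and>
        isometric_embedding (submetric U M) M' j \<longrightarrow>
        (\<exists>g. isometric_embedding M' U g \<and> (\<forall>x\<in>M. g (j x) = x)))"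


section \<open>Lipschitz retractions\<close>

text \<open>Retractions are total functions of the logic; only their values on the carrier matter.\<close>

definition lipschitz1_retraction :: "'a metric \<Rightarrow> 'a set \<Rightarrow> ('a \<Rightarrow> 'a) \<Rightarrow> bool" where
  "lipschitz1_retraction m F Q \<longleftrightarrow>
     F \<subseteq> mspace m \<and> Q ` mspace m = F \<and> (\<forall>x\<in>F. Q x = x) \<and>
     (\<forall>x\<in>mspace m. \<forall>y\<in>mspace m. mdist m (Q x) (Q y) \<le> mdist m x y)"

definition retraction_embedding ::
  "'a metric \<Rightarrow> 'a set \<Rightarrow> ('a \<Rightarrow> 'a) \<Rightarrow> 'b metric \<Rightarrow> 'b set \<Rightarrow> ('b \<Rightarrow> 'b) \<Rightarrow> ('a \<Rightarrow> 'b) \<Rightarrow> bool" where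
  "retraction_embedding m F Q m' F' Q' h \<longleftrightarrow>
     isometric_embedding m m' h \<and>
     (\<forall>x\<in>mspace m. Q' (h x) = h (Q x) \<and> dist_to_set m x F = dist_to_set m' (h x) F')"

definition retraction_isomorphism ::
  "'a metric \<Rightarrow> 'a set \<Rightarrow> ('a \<Rightarrow> 'a) \<Rightarrow> 'b metric \<Rightarrow> 'b set \<Rightarrow> ('b \<Rightarrow> 'b) \<Rightarrow> ('a \<Rightarrow> 'b) \<Rightarrow> bool" where
  "retraction_isomorphism m F Q m' F' Q' h \<longleftrightarrow>
     retraction_embedding m F Q m' F' Q' h \<and> surjective_isometry m m' h"

definition ultrahomogeneous_retraction :: "'a metric \<Rightarrow> 'a set \<Rightarrow> ('a \<Rightarrow> 'a) \<Rightarrow> bool" where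
  "ultrahomogeneous_retraction U F R \<longleftrightarrow>
     (\<forall>A1 A2 f.
        finite A1 \<and> finite A2 \<and> A1 \<subseteq> mspace U \<and> A2 \<subseteq> mspace U \<and>
        surjective_isometry (submetric U A1) (submetric U A2) f \<and>
        (\<forall>x\<in>A1. R x \<in> A1 \<and> f (R x) = R (f x) \<and>
                dist_to_set U x F = dist_to_set U (f x) F) \<longrightarrow>
        (\<exists>g. retraction_isomorphism U F R U F R g \<and> (\<forall>x\<in>A1. g x = f x)))"

text \<open>A separable metric space has at most continuum many points, so carriers inside \<open>real\<close>
  (with an arbitrary metric, unrelated to the usual one) represent all Polish metric spaces up to
  isometry; see \<open>polish_metric_on_real\<close> and \<open>universal_retraction_any_type\<close> below.\<close>

definition universal_retraction :: "'a metric \<Rightarrow> 'a set \<Rightarrow> ('a \<Rightarrow> 'a) \<Rightarrow> bool" where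
  "universal_retraction U F R \<longleftrightarrow>
     (\<forall>(X :: real metric) FX Q.
        polish_metric X \<and> lipschitz1_retraction X FX Q \<longrightarrow>
        (\<exists>h. retraction_embedding X FX Q U F R h))"

text \<open>As for the Urysohn space itself, a retraction is determined up to isomorphism by
  ultrahomogeneity together with universality.  Ultrahomogeneity alone does not suffice: finite
  structures in which all distances to the range are bounded by a fixed \<open>t > 0\<close> also amalgamate,
  and their limits are ultrahomogeneous retractions of the Urysohn space, onto an isometric copy
  of it, which are not isomorphic for different \<open>t\<close>.\<close>


section \<open>Polish metric spaces on arbitrary types\<close>

lemma separable_metric_inj_real:
  fixes m :: "'b metric"
  assumes "separable_space (mtopology_of m)"
  obtains f :: "'b \<Rightarrow> real" where "inj_on f (mspace m)"
proof -
  interpret M: Metric_space "mspace m" "mdist m" by simp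
  obtain C where C: "countable C" "C \<subseteq> mspace m" "M.mtopology closure_of C = mspace m"
    using assms unfolding separable_space_def mtopology_of_def by auto
  define T where "T = (\<lambda>x. {(c, q::rat). c \<in> C \<and> mdist m c x < real_of_rat q})"
  have "inj_on T (mspace m)"
  proof (rule inj_onI, rule ccontr)
    fix x y assume xy: "x \<in> mspace m" "y \<in> mspace m" "T x = T y" "x \<noteq> y"
    define e where "e = mdist m x y / 2"
    have e: "e > 0" using xy by (simp add: e_def)
    have "x \<in> M.mtopology closure_of C" using C xy by simp
    then obtain c where c: "c \<in> C" "mdist m x c < e"
      using e by (auto simp: M.metric_closure_of)
    then obtain q where q: "mdist m x c < real_of_rat q" "real_of_rat q < e"
      using of_rat_dense by blast
    then have "(c, q) \<in> T x" using c by (simp add: T_def M.commute)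
    then have "(c, q) \<in> T y" using xy by simp
    then have "mdist m c y < e" using q by (auto simp: T_def)
    moreover have "mdist m x y \<le> mdist m x c + mdist m c y"
      using M.triangle xy c C by blast
    ultimately show False using c by (simp add: e_def field_simps)
  qed
  moreover have TC: "T x \<subseteq> C \<times> UNIV" for x by (auto simp: T_def)
  moreover have cnt: "countable (C \<times> (UNIV :: rat set))" using C by auto
  ultimately have "inj_on (\<lambda>x. to_nat_on (C \<times> (UNIV :: rat set)) ` T x) (mspace m)"
    unfolding inj_on_def inj_on_image_eq_iff[OF inj_on_to_nat_on[OF cnt] TC TC]
    by blast
  moreover obtain k :: "nat set \<Rightarrow> real" where "inj k"
    using nat_sets_eqpoll_reals unfolding eqpoll_def bij_betw_def by auto
  ultimately show ?thesis
    by (intro that[of "k \<circ> (\<lambda>x. to_nat_on (C \<times> (UNIV :: rat set)) ` T x)"])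
       (auto intro!: comp_inj_on intro: inj_on_subset)
qed

lemma polish_metric_on_real:
  fixes m :: "'b metric"
  assumes "polish_metric m"
  obtains X :: "real metric" and f where "polish_metric X" "surjective_isometry m X f"
proof -
  interpret M: Metric_space "mspace m" "mdist m" by simp
  obtain f :: "'b \<Rightarrow> real" where f: "inj_on f (mspace m)"
    using separable_metric_inj_real assms unfolding polish_metric_def by blast
  define g where "g = inv_into (mspace m) f"
  have gf: "g (f x) = x" if "x \<in> mspace m" for x using f that by (simp add: g_def)
  define S where "S = f ` mspace m"
  define d where "d = (\<lambda>x y. mdist m (g x) (g y))"
  have ms: "Metric_space S d"
    by unfold_locales (auto simp: S_def d_def gf M.commute intro: M.triangle)
  interpret X: Metric_space S d by (rule ms)
  interpret MX: Metric_space12 "mspace m" "mdist m" S d by unfold_locales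
  have gS: "g x \<in> mspace m" if "x \<in> S" for x using that by (auto simp: S_def gf)
  have fg: "f (g x) = x" if "x \<in> S" for x using that by (auto simp: S_def gf)
  have iso: "surjective_isometry m (metric (S, d)) f"
    by (auto simp: surjective_isometry_def isometric_embedding_def S_def[symmetric])
       (auto simp: S_def d_def gf)
  have "homeomorphic_map M.mtopology X.mtopology f"
    by (rule MX.isometry_imp_homeomorphic_map) (auto simp: S_def d_def gf)
  then have "continuous_map M.mtopology X.mtopology f" "f ` topspace M.mtopology = topspace X.mtopology"
    by (auto simp: homeomorphic_eq_everything_map)
  then have sep: "separable_space X.mtopology"
    using assms separable_space_continuous_map_image
    unfolding polish_metric_def mtopology_of_def by blast
  have "X.mcomplete"
    unfolding X.mcomplete_def
  proof (intro allI impI)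
    fix s assume s: "X.MCauchy s"
    have "M.MCauchy (g \<circ> s)"
      using s gS unfolding X.MCauchy_def M.MCauchy_def by (auto simp: d_def image_subset_iff)
    then obtain l where l: "limitin M.mtopology (g \<circ> s) l sequentially"
      using assms unfolding polish_metric_def mcomplete_of_def M.mcomplete_def by blast
    then have "limitin X.mtopology (f \<circ> (g \<circ> s)) (f l) sequentially"
      using continuous_map_limit[OF \<open>continuous_map M.mtopology X.mtopology f\<close>] by blast
    moreover have "f \<circ> (g \<circ> s) = s"
      using s fg unfolding X.MCauchy_def by (auto simp: fun_eq_iff)
    ultimately show "\<exists>x. limitin X.mtopology s x sequentially" by auto
  qed
  then have "polish_metric (metric (S, d))"
    using sep by (simp add: polish_metric_def mtopology_of_def)
  then show ?thesis using that iso by blast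
qed

lemma universal_retraction_any_type:
  fixes m :: "'b metric"
  assumes U: "universal_retraction U F R"
    and m: "polish_metric m" "lipschitz1_retraction m E Q"
  shows "\<exists>h. retraction_embedding m E Q U F R h"
proof -
  obtain X :: "real metric" and f where X: "polish_metric X" and f: "surjective_isometry m X f"
    using polish_metric_on_real m by blast
  have f': "f ` mspace m = mspace X" "\<And>x y. x \<in> mspace m \<Longrightarrow> y \<in> mspace m \<Longrightarrow> mdist X (f x) (f y) = mdist m x y"
    using f by (auto simp: surjective_isometry_def isometric_embedding_def)
  have inj: "inj_on f (mspace m)"
    by (rule inj_onI) (metis f'(2) mdist_zero)
  define g where "g = inv_into (mspace m) f"
  have gf: "g (f x) = x" if "x \<in> mspace m" for x using inj that by (simp add: g_def)
  have E: "E \<subseteq> mspace m" and QE: "Q ` mspace m = E" and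
    Q: "\<And>x. x \<in> E \<Longrightarrow> Q x = x" "\<And>x y. x \<in> mspace m \<Longrightarrow> y \<in> mspace m \<Longrightarrow> mdist m (Q x) (Q y) \<le> mdist m x y"
    using m(2) by (auto simp: lipschitz1_retraction_def)
  have Qm: "Q x \<in> mspace m" if "x \<in> mspace m" for x using E QE that by auto
  have "lipschitz1_retraction X (f ` E) (f \<circ> Q \<circ> g)"
    unfolding lipschitz1_retraction_def
  proof (intro conjI)
    show "f ` E \<subseteq> mspace X" using E f' by auto
    show "(f \<circ> Q \<circ> g) ` mspace X = f ` E"
      unfolding f'(1)[symmetric] QE[symmetric] by (force simp: gf image_iff)
    show "\<forall>x\<in>f ` E. (f \<circ> Q \<circ> g) x = x" using E Q by (auto simp: gf subset_iff)
    show "\<forall>x\<in>mspace X. \<forall>y\<in>mspace X. mdist X ((f \<circ> Q \<circ> g) x) ((f \<circ> Q \<circ> g) y) \<le> mdist X x y"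
      unfolding f'(1)[symmetric] by (auto simp: gf f'(2) Qm Q)
  qed
  then obtain h where h: "retraction_embedding X (f ` E) (f \<circ> Q \<circ> g) U F R h"
    using U X unfolding universal_retraction_def by blast
  have "dist_to_set X (f x) (f ` E) = dist_to_set m x E" if "x \<in> mspace m" for x
    unfolding dist_to_set_def image_image
    by (rule INF_cong) (use that E f' in auto)
  then have "retraction_embedding m E Q U F R (h \<circ> f)"
    using h unfolding retraction_embedding_def isometric_embedding_def f'(1)[symmetric]
    by (auto simp: gf f'(2))
  then show ?thesis by blast
qed

end

theory Submission
  imports Defs
begin

text \<open>
  A \<open>1\<close>-Lipschitz retraction \<open>R\<close> with range \<open>F\<close> is studied through the triple of the metric, \<open>R\<close>
  and the function \<open>\<delta>\<close> that gives the distance to \<open>F\<close>. Besides Lipschitz conditions the triple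
  satisfies one hidden constraint, \<open>d x (R x) \<le> 2 * \<delta> x\<close>. Together these conditions
  (\<open>retraction_structure\<close>) are all that can be said: a finite structure that satisfies them can be
  enlarged by points of the range that attain the distances prescribed by \<open>\<delta>\<close>, by placing such a
  point at distance \<open>\<delta> x\<close> from both \<open>x\<close> and \<open>R x\<close>. So \<open>\<delta>\<close> may be treated as an abstract part of the
  structure, and a finite extension may be described without reference to the infinite set \<open>F\<close>.

  The whole theorem is then a matter of one-point extensions. Call a structure on the Urysohn space
  rich if every one-point type over every finite substructure is realised
  (\<open>extension_property\<close>). A rich structure accepts the next point of any other structure
  (\<open>forth_if_extension_property\<close>), so the argument going back and forth on finite partial isomorphisms
  yields ultrahomogeneity, and its forth half alone yields universality. In a rich structure the
  abstract \<open>\<delta>\<close> really is the distance to the range (\<open>distance_to_range\<close>), and the range inherits the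
  extension property of the Urysohn space, hence is isometric to it (\<open>range_isometric\<close>). For
  uniqueness, a retraction that is universal and ultrahomogeneous also accepts the next point of any
  other one (\<open>forth_if_universal_ultrahomogeneous\<close>), so the back-and-forth argument applies between it
  and the rich one.

  It remains to construct a rich structure. It is built inside the given Urysohn space as the union of
  a generic chain of finite structures on finite subsets (\<open>generic_structure\<close>). Every point of a dense
  sequence can be absorbed (\<open>add_point\<close>), so the union is dense and its structure extends by
  continuity. There are uncountably many types and only countably many steps, so genericity realises
  types merely up to arbitrarily small errors (\<open>approximate_realisation\<close>). The errors are removed by
  completeness: a type and an approximate realisation of it can be amalgamated at a small distance
  (\<open>type_near_approximation\<close>), and so a sequence of better and better realisations can be kept Cauchy
  (\<open>exact_realisation\<close>).
\<close>

section \<open>Dense subsets and completeness\<close>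

lemma le_if_le_add_multiple:
  fixes x y c :: real
  assumes "c > 0" and "\<And>e. e > 0 \<Longrightarrow> x \<le> y + c * e"
  shows "x \<le> y"
proof (rule field_le_epsilon)
  fix e :: real assume "e > 0"
  then show "x \<le> y + e" using assms(2)[of "e / c"] assms(1) by simp
qed

lemma mdist_self [simp]: "x \<in> mspace m \<Longrightarrow> mdist m x x = 0"
  by simp

definition dense_in :: "'a metric \<Rightarrow> 'a set \<Rightarrow> bool" where
  "dense_in m D \<longleftrightarrow> D \<subseteq> mspace m \<and> (\<forall>x\<in>mspace m. \<forall>e>0. \<exists>a\<in>D. mdist m x a < e)"

text \<open>Completeness tested on sequences with geometric steps only. All sequences below are constructed with
such steps, and this form carries over directly from a space to its range under a retraction.\<close>

definition fast_complete :: "'a metric \<Rightarrow> bool" where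
  "fast_complete m \<longleftrightarrow>
     (\<forall>s. (\<forall>n. s n \<in> mspace m) \<and> (\<forall>n. mdist m (s n) (s (Suc n)) \<le> (1/2) ^ n) \<longrightarrow>
          (\<exists>l\<in>mspace m. (\<lambda>n. mdist m (s n) l) \<longlonglongrightarrow> 0))"

lemma fast_completeD:
  assumes "fast_complete m" "\<And>n. s n \<in> mspace m" "\<And>n. mdist m (s n) (s (Suc n)) \<le> (1/2) ^ n"
  obtains l where "l \<in> mspace m" "(\<lambda>n. mdist m (s n) l) \<longlonglongrightarrow> 0"
  using assms unfolding fast_complete_def by blast

lemma dist_le_geometric_tail:
  assumes "\<And>n. s n \<in> mspace m" "\<And>n. mdist m (s n) (s (Suc n)) \<le> (1/2) ^ n"
  shows "mdist m (s n) (s (n + k)) \<le> 2 * (1/2) ^ n - 2 * (1/2) ^ (n + k)"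
proof (induction k)
  case 0 show ?case using assms(1) by simp
next
  case (Suc k)
  have "mdist m (s n) (s (n + Suc k)) \<le> mdist m (s n) (s (n + k)) + mdist m (s (n + k)) (s (Suc (n + k)))"
    using assms(1) mdist_triangle[of "s n" m "s (n + k)" "s (n + Suc k)"] by simp
  then show ?case using Suc assms(2)[of "n + k"] by simp
qed

lemma fast_complete_if_mcomplete:
  assumes "mcomplete_of m"
  shows "fast_complete m"
  unfolding fast_complete_def
proof (intro allI impI, elim conjE)
  fix s assume s: "\<forall>n. s n \<in> mspace m" "\<forall>n. mdist m (s n) (s (Suc n)) \<le> (1/2) ^ n"
  interpret M: Metric_space "mspace m" "mdist m" by simp
  have tail: "mdist m (s n) (s (n + k)) \<le> 2 * (1/2) ^ n" for n k
  proof -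
    have "0 \<le> (1/2 :: real) ^ (n + k)" by simp
    moreover have "mdist m (s n) (s (n + k)) \<le> 2 * (1/2) ^ n - 2 * (1/2) ^ (n + k)"
      using s by (intro dist_le_geometric_tail) auto
    ultimately show ?thesis by linarith
  qed
  have "M.MCauchy s"
    unfolding M.MCauchy_def
  proof (intro conjI allI impI)
    show "range s \<subseteq> mspace m" using s by auto
    fix e :: real assume "e > 0"
    then obtain N where N: "(1/2) ^ N < e / 4"
      using real_arch_pow_inv[of "e / 4" "1/2"] by auto
    show "\<exists>N. \<forall>n n'. N \<le> n \<longrightarrow> N \<le> n' \<longrightarrow> mdist m (s n) (s n') < e"
    proof (intro exI allI impI)
      fix n n' assume n: "N \<le> n" "N \<le> n'"
      have "mdist m (s n) (s n') \<le> mdist m (s n) (s N) + mdist m (s N) (s n')"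
        using s by (simp add: mdist_triangle)
      moreover have "mdist m (s N) (s n) \<le> 2 * (1/2) ^ N" "mdist m (s N) (s n') \<le> 2 * (1/2) ^ N"
        using tail[of N "n - N"] tail[of N "n' - N"] n by simp_all
      ultimately show "mdist m (s n) (s n') < e" using N by (simp add: mdist_commute)
    qed
  qed
  then obtain l where l: "limitin M.mtopology s l sequentially"
    using assms unfolding mcomplete_of_def M.mcomplete_def by blast
  then have "l \<in> mspace m" "(\<lambda>n. mdist m (s n) l) \<longlonglongrightarrow> 0"
    using M.limitin_metric_dist_null by blast+
  then show "\<exists>l\<in>mspace m. (\<lambda>n. mdist m (s n) l) \<longlonglongrightarrow> 0" by blast
qed

lemma fast_complete_real: "fast_complete (euclidean_metric :: real metric)"
proof (rule fast_complete_if_mcomplete)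
  have "complete (UNIV :: real set)" by (rule complete_UNIV)
  then show "mcomplete_of (euclidean_metric :: real metric)"
    unfolding euclidean_metric_def using Met_TC.mcomplete_of mcomplete_iff_complete
    by (simp add: mcomplete_of_def)
qed

lemma polish_dense_sequence:
  assumes "polish_metric m" "mspace m \<noteq> {}"
  obtains c :: "nat \<Rightarrow> 'a" where "dense_in m (range c)"
proof -
  interpret M: Metric_space "mspace m" "mdist m" by simp
  obtain C where C: "countable C" "C \<subseteq> mspace m" "M.mtopology closure_of C = mspace m"
    using assms unfolding polish_metric_def separable_space_def mtopology_of_def by auto
  have d: "dense_in m C"
    unfolding dense_in_def
  proof (intro conjI ballI allI impI)
    show "C \<subseteq> mspace m" by (rule C)
    fix x and e :: real assume x: "x \<in> mspace m" "e > 0"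
    then have "x \<in> M.mtopology closure_of C" using C by simp
    then show "\<exists>a\<in>C. mdist m x a < e" using x by (auto simp: M.metric_closure_of)
  qed
  moreover have "C \<noteq> {}" using d assms(2) unfolding dense_in_def
    by (metis ex_in_conv zero_less_one)
  ultimately have "dense_in m (range (from_nat_into C))" using C by simp
  then show ?thesis by (rule that)
qed

lemma dense_inE:
  assumes "dense_in m D" "x \<in> mspace m" "e > 0"
  obtains a where "a \<in> D" "a \<in> mspace m" "mdist m x a < e"
  using assms unfolding dense_in_def by blast

text \<open>The value at a point is the limit of the values along a fast sequence of points of \<open>D\<close>. The lemma
serves three times: for partial isometries, for retractions, and for the distance functions, where
the target is the real line.\<close>

lemma lipschitz_extension:
  assumes D: "dense_in m D" and m': "fast_complete m'"
    and P: "\<And>a. a \<in> D \<Longrightarrow> P a \<in> mspace m'"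
    and lip: "\<And>a b. a \<in> D \<Longrightarrow> b \<in> D \<Longrightarrow> mdist m' (P a) (P b) \<le> mdist m a b"
  obtains h where "\<And>x. x \<in> mspace m \<Longrightarrow> h x \<in> mspace m'"
    "\<And>x y. x \<in> mspace m \<Longrightarrow> y \<in> mspace m \<Longrightarrow> mdist m' (h x) (h y) \<le> mdist m x y"
    "\<And>a. a \<in> D \<Longrightarrow> h a = P a"
proof -
  \<comment> \<open>A point of \<open>D\<close> is approximated by itself, so that the limit reproduces \<open>P\<close> there.\<close>
  have "\<forall>x n. x \<in> mspace m \<longrightarrow> (\<exists>a\<in>D. a \<in> mspace m \<and> mdist m x a < (1/2) ^ n / 4 \<and> (x \<in> D \<longrightarrow> a = x))"
  proof (intro allI impI)
    fix x and n :: nat assume x: "x \<in> mspace m"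
    show "\<exists>a\<in>D. a \<in> mspace m \<and> mdist m x a < (1/2) ^ n / 4 \<and> (x \<in> D \<longrightarrow> a = x)"
    proof (cases "x \<in> D")
      case True then show ?thesis using x by (intro bexI[of _ x]) simp_all
    next
      case False
      then show ?thesis using dense_inE[OF D x, of "(1/2) ^ n / 4"] by auto
    qed
  qed
  then obtain s where s: "\<And>x n. x \<in> mspace m \<Longrightarrow> s x n \<in> D \<and> s x n \<in> mspace m \<and>
      mdist m x (s x n) < (1/2) ^ n / 4 \<and> (x \<in> D \<longrightarrow> s x n = x)"
    by metis
  have "\<exists>l\<in>mspace m'. (\<lambda>n. mdist m' (P (s x n)) l) \<longlonglongrightarrow> 0" if x: "x \<in> mspace m" for x
  proof (rule fast_completeD[OF m', of "\<lambda>n. P (s x n)"])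
    fix n
    show "P (s x n) \<in> mspace m'" using s[OF x] P by blast
    have "mdist m' (P (s x n)) (P (s x (Suc n))) \<le> mdist m (s x n) (s x (Suc n))"
      using s[OF x] lip by blast
    also have "\<dots> \<le> mdist m (s x n) x + mdist m x (s x (Suc n))"
      using s[OF x] x mdist_triangle by metis
    also have "\<dots> \<le> (1/2) ^ n / 4 + (1/2) ^ Suc n / 4"
      using s[OF x, of n] s[OF x, of "Suc n"] by (simp add: mdist_commute)
    also have "\<dots> \<le> (1/2) ^ n" by simp
    finally show "mdist m' (P (s x n)) (P (s x (Suc n))) \<le> (1/2) ^ n" .
  qed blast
  then obtain h where h: "\<And>x. x \<in> mspace m \<Longrightarrow> h x \<in> mspace m'"
      "\<And>x. x \<in> mspace m \<Longrightarrow> (\<lambda>n. mdist m' (P (s x n)) (h x)) \<longlonglongrightarrow> 0"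
    by metis
  show ?thesis
  proof (rule that[OF h(1)])
    fix a assume a: "a \<in> D"
    then have am: "a \<in> mspace m" using D by (auto simp: dense_in_def)
    then have "(\<lambda>n. mdist m' (P a) (h a)) \<longlonglongrightarrow> 0" using h(2)[OF am] s[OF am] a by simp
    then have "mdist m' (P a) (h a) = 0" using LIMSEQ_unique tendsto_const by blast
    then show "h a = P a" using h(1)[OF am] P[OF a] by simp
  next
    fix x y assume xy: "x \<in> mspace m" "y \<in> mspace m"
    let ?u = "\<lambda>n. mdist m' (P (s x n)) (h x) + (mdist m x y + (1/2) ^ n) + mdist m' (P (s y n)) (h y)"
    have "?u \<longlonglongrightarrow> 0 + (mdist m x y + 0) + 0"
      by (intro tendsto_add h xy tendsto_const LIMSEQ_power_zero) simp
    moreover have "mdist m' (h x) (h y) \<le> ?u n" for n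
    proof -
      have Pm: "P (s x n) \<in> mspace m'" "P (s y n) \<in> mspace m'" using s xy P by blast+
      have "mdist m' (h x) (h y) \<le> mdist m' (h x) (P (s x n)) + mdist m' (P (s x n)) (h y)"
        "mdist m' (P (s x n)) (h y) \<le> mdist m' (P (s x n)) (P (s y n)) + mdist m' (P (s y n)) (h y)"
        using Pm h xy by (auto intro!: mdist_triangle)
      moreover have "mdist m' (P (s x n)) (P (s y n)) \<le> mdist m (s x n) (s y n)"
        using s xy lip by blast
      moreover have "mdist m (s x n) (s y n) \<le> mdist m (s x n) x + mdist m x (s y n)"
        "mdist m x (s y n) \<le> mdist m x y + mdist m y (s y n)"
        using s xy by (auto intro!: mdist_triangle)
      moreover have "mdist m (s x n) x < (1/2) ^ n / 4" "mdist m y (s y n) < (1/2) ^ n / 4"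
        using s xy by (simp_all add: mdist_commute)
      moreover have "0 \<le> (1/2 :: real) ^ n" by simp
      moreover have "mdist m' (h x) (P (s x n)) = mdist m' (P (s x n)) (h x)" by (rule mdist_commute)
      ultimately show ?thesis by linarith
    qed
    ultimately show "mdist m' (h x) (h y) \<le> mdist m x y"
      using LIMSEQ_le_const[of ?u "0 + (mdist m x y + 0) + 0" "mdist m' (h x) (h y)"] by simp
  qed
qed

lemma isometric_extension:
  assumes D: "dense_in m D" and m': "fast_complete m'"
    and P: "\<And>a. a \<in> D \<Longrightarrow> P a \<in> mspace m'"
    and iso: "\<And>a b. a \<in> D \<Longrightarrow> b \<in> D \<Longrightarrow> mdist m' (P a) (P b) = mdist m a b"
  obtains h where "isometric_embedding m m' h" "\<And>a. a \<in> D \<Longrightarrow> h a = P a"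
proof -
  obtain h where h: "\<And>x. x \<in> mspace m \<Longrightarrow> h x \<in> mspace m'"
    "\<And>x y. x \<in> mspace m \<Longrightarrow> y \<in> mspace m \<Longrightarrow> mdist m' (h x) (h y) \<le> mdist m x y"
    "\<And>a. a \<in> D \<Longrightarrow> h a = P a"
    by (rule lipschitz_extension[OF D m' P]) (auto simp: iso)
  have "mdist m x y \<le> mdist m' (h x) (h y)" if xy: "x \<in> mspace m" "y \<in> mspace m" for x y
  proof (rule le_if_le_add_multiple[of 4])
    fix e :: real assume e: "e > 0"
    obtain a where a: "a \<in> D" "a \<in> mspace m" "mdist m x a < e" by (rule dense_inE[OF D xy(1) e])
    obtain b where b: "b \<in> D" "b \<in> mspace m" "mdist m y b < e" by (rule dense_inE[OF D xy(2) e])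
    have "mdist m x y \<le> mdist m x a + mdist m a y" "mdist m a y \<le> mdist m a b + mdist m b y"
      using a b xy by (auto intro!: mdist_triangle)
    moreover have "mdist m' (h a) (h b) \<le> mdist m' (h a) (h x) + mdist m' (h x) (h b)"
      "mdist m' (h x) (h b) \<le> mdist m' (h x) (h y) + mdist m' (h y) (h b)"
      using a b xy h(1) by (auto intro!: mdist_triangle)
    moreover have "mdist m' (h a) (h x) \<le> mdist m a x" "mdist m' (h y) (h b) \<le> mdist m y b"
      using a b xy h(2) by auto
    moreover have "mdist m' (h a) (h b) = mdist m a b" using a b h(3) iso by simp
    ultimately show "mdist m x y \<le> mdist m' (h x) (h y) + 4 * e"
      using a b by (simp add: mdist_commute)
  qed simp
  then have "isometric_embedding m m' h"
    using h by (auto simp: isometric_embedding_def intro: antisym)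
  then show ?thesis using h(3) that by blast
qed

section \<open>Retraction structures and one-point types\<close>

text \<open>The conditions that a \<open>1\<close>-Lipschitz retraction \<open>Q\<close> and the distance \<open>\<delta>\<close> to its range satisfy
on a set closed under \<open>Q\<close>, whether or not that set contains points of the range that come close to
realising the distance. The bound by \<open>2 * \<delta> x\<close> is the only condition that is not immediate: a
point \<open>y\<close> of the range has \<open>d y (Q x) \<le> d y x\<close>, hence \<open>d x (Q x) \<le> 2 * d x y\<close>. With \<open>\<delta> (Q x) = 0\<close>
it makes \<open>Q\<close> idempotent and the range the zero set of \<open>\<delta>\<close>. All conditions are closed, so they
survive passage to limits.\<close>

definition retraction_structure :: "'a metric \<Rightarrow> 'a set \<Rightarrow> ('a \<Rightarrow> 'a) \<Rightarrow> ('a \<Rightarrow> real) \<Rightarrow> bool" where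
  "retraction_structure m D Q \<delta> \<longleftrightarrow>
     D \<subseteq> mspace m \<and>
     (\<forall>x\<in>D. Q x \<in> D \<and> \<delta> (Q x) = 0 \<and> mdist m x (Q x) \<le> 2 * \<delta> x) \<and>
     (\<forall>x\<in>D. \<forall>y\<in>D. mdist m (Q x) (Q y) \<le> mdist m x y \<and> \<delta> x \<le> \<delta> y + mdist m x y)"

lemma retraction_structureD:
  assumes "retraction_structure m D Q \<delta>"
  shows "D \<subseteq> mspace m" "x \<in> D \<Longrightarrow> x \<in> mspace m"
    "x \<in> D \<Longrightarrow> Q x \<in> D" "x \<in> D \<Longrightarrow> \<delta> (Q x) = 0" "x \<in> D \<Longrightarrow> mdist m x (Q x) \<le> 2 * \<delta> x"
    "x \<in> D \<Longrightarrow> y \<in> D \<Longrightarrow> mdist m (Q x) (Q y) \<le> mdist m x y"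
    "x \<in> D \<Longrightarrow> y \<in> D \<Longrightarrow> \<delta> x \<le> \<delta> y + mdist m x y"
  using assms unfolding retraction_structure_def by blast+

lemma retraction_structure_nonneg:
  assumes "retraction_structure m D Q \<delta>" "x \<in> D"
  shows "0 \<le> \<delta> x"
  using retraction_structureD(5)[OF assms] mdist_nonneg[of m x "Q x"] by linarith

lemma retraction_structure_fixed:
  assumes S: "retraction_structure m D Q \<delta>" and x: "x \<in> D" "\<delta> x = 0"
  shows "Q x = x"
proof -
  have "mdist m x (Q x) \<le> 0" using retraction_structureD(5)[OF S x(1)] x(2) by simp
  then have "mdist m x (Q x) = 0" using mdist_nonneg by (metis order_antisym)
  then show ?thesis using retraction_structureD(2,3)[OF S] x by simp
qed

lemma retraction_structure_idem:
  assumes S: "retraction_structure m D Q \<delta>" and x: "x \<in> D"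
  shows "Q (Q x) = Q x"
  by (rule retraction_structure_fixed[OF S]) (simp_all add: retraction_structureD[OF S] x)

lemma retraction_structure_cong:
  assumes "retraction_structure m D Q \<delta>" "\<And>x. x \<in> D \<Longrightarrow> Q' x = Q x" "\<And>x. x \<in> D \<Longrightarrow> \<delta>' x = \<delta> x"
  shows "retraction_structure m D Q' \<delta>'"
  using assms unfolding retraction_structure_def by simp

text \<open>These are exactly the functions that arise as the distances from one additional point, which is
allowed to coincide with a point of \<open>D\<close>.\<close>

definition katetov :: "'a metric \<Rightarrow> 'a set \<Rightarrow> ('a \<Rightarrow> real) \<Rightarrow> bool" where
  "katetov m D f \<longleftrightarrow> (\<forall>a\<in>D. \<forall>b\<in>D. f a \<le> f b + mdist m a b \<and> mdist m a b \<le> f a + f b)"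

lemma katetovD:
  assumes "katetov m D f" "a \<in> D" "b \<in> D"
  shows "f a \<le> f b + mdist m a b" "mdist m a b \<le> f a + f b"
  using assms unfolding katetov_def by blast+

lemma katetov_nonneg:
  assumes "katetov m D f" "a \<in> D"
  shows "0 \<le> f a"
  using katetovD(2)[OF assms(1) assms(2) assms(2)] mdist_nonneg[of m a a] by linarith

lemma katetov_mono: "katetov m D f \<Longrightarrow> E \<subseteq> D \<Longrightarrow> katetov m E f"
  unfolding katetov_def by blast

lemma katetov_mdist:
  assumes "D \<subseteq> mspace m" "x \<in> mspace m"
  shows "katetov m D (mdist m x)"
  unfolding katetov_def
proof (intro ballI conjI)
  fix a b assume "a \<in> D" "b \<in> D"
  then have ab: "a \<in> mspace m" "b \<in> mspace m" using assms by auto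
  show "mdist m x a \<le> mdist m x b + mdist m a b"
    using mdist_triangle[of x m b a] ab assms by (simp add: mdist_commute)
  show "mdist m a b \<le> mdist m x a + mdist m x b"
    using mdist_triangle[of a m x b] ab assms by (simp add: mdist_commute)
qed

text \<open>What a structure on \<open>D\<close> sees of one additional point \<open>x\<close>: the distances \<open>f\<close> to \<open>D\<close>, the distance
\<open>r\<close> to the range, and the image under the retraction. For \<open>None\<close> the image is \<open>x\<close> itself, so \<open>x\<close>
is a point of the range; for \<open>Some c\<close> it is the point \<open>c\<close> of the range, already in \<open>D\<close>. The
inequalities say that the structure stays a retraction structure when \<open>x\<close> is added. Adding first
\<open>Q x\<close> and then \<open>x\<close>, every finite extension is a succession of such steps.\<close>

definition one_point_type ::
  "'a metric \<Rightarrow> 'a set \<Rightarrow> ('a \<Rightarrow> 'a) \<Rightarrow> ('a \<Rightarrow> real) \<Rightarrow> ('a \<Rightarrow> real) \<Rightarrow> 'a option \<Rightarrow> real \<Rightarrow> bool" where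
  "one_point_type m D Q \<delta> f q r \<longleftrightarrow>
     katetov m D f \<and>
     (\<forall>a\<in>D. r \<le> \<delta> a + f a \<and> \<delta> a \<le> r + f a) \<and>
     (case q of
        None \<Rightarrow> r = 0 \<and> (\<forall>a\<in>D. f (Q a) \<le> f a)
      | Some c \<Rightarrow> c \<in> D \<and> \<delta> c = 0 \<and> f c \<le> 2 * r \<and> (\<forall>a\<in>D. mdist m c (Q a) \<le> f a))"

definition image_point :: "'a option \<Rightarrow> 'a \<Rightarrow> 'a" where
  "image_point q x = (case q of None \<Rightarrow> x | Some c \<Rightarrow> c)"

lemma image_point_simps [simp]: "image_point None x = x" "image_point (Some c) x = c"
  by (simp_all add: image_point_def)

lemma one_point_type_mono:
  assumes "one_point_type m D Q \<delta> f q r" "E \<subseteq> D" "\<And>c. q = Some c \<Longrightarrow> c \<in> E"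
  shows "one_point_type m E Q \<delta> f q r"
proof (cases q)
  case None
  then show ?thesis using assms katetov_mono[of m D f E] unfolding one_point_type_def by auto
next
  case (Some c)
  then show ?thesis using assms katetov_mono[of m D f E] unfolding one_point_type_def by auto
qed

lemma one_point_type_cong:
  assumes "one_point_type m D Q \<delta> f q r"
    and "\<And>a. a \<in> D \<Longrightarrow> Q' a = Q a" "\<And>a. a \<in> D \<Longrightarrow> \<delta>' a = \<delta> a"
  shows "one_point_type m D Q' \<delta>' f q r"
  using assms unfolding one_point_type_def by (auto split: option.splits)

text \<open>A point with the prescribed distances carries the type once \<open>Q\<close> and \<open>\<delta>\<close> are given the prescribed
values there.\<close>

lemma realise_type:
  assumes S: "retraction_structure m D Q \<delta>" and T: "one_point_type m D Q \<delta> f q r"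
    and x: "x \<in> mspace m" "\<And>a. a \<in> D \<Longrightarrow> mdist m x a = f a"
  obtains Q' \<delta>' where "retraction_structure m (insert x D) Q' \<delta>'"
    "\<And>a. a \<in> D \<Longrightarrow> Q' a = Q a" "\<And>a. a \<in> D \<Longrightarrow> \<delta>' a = \<delta> a" "Q' x = image_point q x" "\<delta>' x = r"
proof -
  note SD = retraction_structureD[OF S]
  let ?Q = "Q(x := image_point q x)" and ?d = "\<delta>(x := r)"
  have sub: "Q a \<in> mspace m" if "a \<in> D" for a using SD that by blast
  have r: "\<And>a. a \<in> D \<Longrightarrow> r \<le> \<delta> a + mdist m x a" "\<And>a. a \<in> D \<Longrightarrow> \<delta> a \<le> r + mdist m x a"
    using T x unfolding one_point_type_def by auto
  have xc: "mdist m a x = mdist m x a" for a by (rule mdist_commute)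
  \<comment> \<open>A point that already lies in \<open>D\<close> realises its own type, so the update changes nothing.\<close>
  have old: "Q x = image_point q x \<and> \<delta> x = r" if xD: "x \<in> D"
  proof -
    have f0: "f x = 0" using x(2)[OF xD] x(1) by simp
    have "\<delta> x = r" using r[OF xD] x(1) by simp
    moreover have "Q x = image_point q x"
    proof (cases q)
      case None
      then have "\<delta> x = 0" using T \<open>\<delta> x = r\<close> by (simp add: one_point_type_def)
      then show ?thesis using retraction_structure_fixed[OF S xD] None by simp
    next
      case (Some c)
      then have "c \<in> D" "mdist m c (Q x) \<le> 0" using T xD f0 by (auto simp: one_point_type_def)
      then have "mdist m c (Q x) = 0" using mdist_nonneg by (metis order_antisym)
      then show ?thesis using Some \<open>c \<in> D\<close> sub[OF xD] SD(2) by simp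
    qed
    ultimately show ?thesis by simp
  qed
  have agree: "?Q a = Q a" "?d a = \<delta> a" if "a \<in> D" for a
    using old that by auto
  have qx: "image_point q x \<in> insert x D \<and> ?d (image_point q x) = 0
      \<and> mdist m x (image_point q x) \<le> 2 * r
      \<and> (\<forall>a\<in>D. mdist m (image_point q x) (Q a) \<le> mdist m x a)"
  proof (cases q)
    case None
    have "mdist m x (Q a) \<le> mdist m x a" if "a \<in> D" for a
      using T None that x(2) SD(3) by (simp add: one_point_type_def)
    then show ?thesis using None T x(1) by (simp add: one_point_type_def)
  next
    case (Some c)
    then have c: "c \<in> D" "\<delta> c = 0" using T by (auto simp: one_point_type_def)
    then have "?d c = 0" using agree by simp
    then show ?thesis using Some T c x(2) by (simp add: one_point_type_def)
  qed
  have "retraction_structure m (insert x D) ?Q ?d"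
    unfolding retraction_structure_def
  proof (intro conjI ballI)
    show "insert x D \<subseteq> mspace m" using x SD by simp
    fix a assume a: "a \<in> insert x D"
    show "?Q a \<in> insert x D" "?d (?Q a) = 0" "mdist m a (?Q a) \<le> 2 * ?d a"
      using qx a agree SD(3-5) by (metis fun_upd_same insertE insertI2)+
    fix b assume b: "b \<in> insert x D"
    have ip: "image_point q x \<in> mspace m" using qx x(1) SD(1) by (metis insertE subsetD)
    consider "a = x" "b = x" | "a = x" "b \<in> D" | "a \<in> D" "b = x" | "a \<in> D" "b \<in> D"
      using a b by blast
    then show "mdist m (?Q a) (?Q b) \<le> mdist m a b"
    proof cases
      case 1 then show ?thesis using x(1) ip by simp
    next
      case 2
      then have "?Q a = image_point q x" "?Q b = Q b" using agree by auto
      then show ?thesis using qx 2 by auto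
    next
      case 3
      then have "?Q b = image_point q x" "?Q a = Q a" using agree by auto
      then show ?thesis using qx 3 by (metis mdist_commute)
    next
      case 4 then show ?thesis using agree SD(6) by metis
    qed
    show "?d a \<le> ?d b + mdist m a b"
      using a b
    proof (elim insertE)
      assume "a = x" "b = x" then show ?thesis using x(1) by simp
    next
      assume "a = x" "b \<in> D" then show ?thesis using r agree by (metis fun_upd_same)
    next
      assume "a \<in> D" "b = x" then show ?thesis using r agree xc by (metis fun_upd_same)
    next
      assume "a \<in> D" "b \<in> D" then show ?thesis using agree SD(7) by metis
    qed
  qed
  then show ?thesis by (rule that) (use agree in auto)
qed

text \<open>The metric space on natural numbers required by the definition of the Urysohn space is \<open>D\<close>, moved
to positive numbers, with \<open>0\<close> as the additional point. If \<open>f\<close> vanishes somewhere, this would not be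
a metric, but then the point where it vanishes already has the right distances.\<close>

lemma urysohn_one_point:
  assumes U: "urysohn_space U" and D: "finite D" "D \<subseteq> mspace U" and f: "katetov U D f"
  obtains x where "x \<in> mspace U" "\<And>a. a \<in> D \<Longrightarrow> mdist U x a = f a"
proof (cases "\<exists>x\<in>D. f x = 0")
  case True
  then obtain x where x: "x \<in> D" "f x = 0" by blast
  have "mdist U x a = f a" if "a \<in> D" for a
    using katetovD[OF f x(1) that] katetovD[OF f that x(1)] x(2) by (simp add: mdist_commute)
  then show ?thesis using that x D by blast
next
  case False
  then have pos: "f a > 0" if "a \<in> D" for a
    using katetov_nonneg[OF f that] that by (metis order_le_less)
  obtain e :: "'a \<Rightarrow> nat" where e: "inj_on e D" using D(1) finite_imp_inj_to_nat_seg by metis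
  define j where "j = (\<lambda>a. Suc (e a))"
  have j: "inj_on j D" using e by (simp add: j_def inj_on_def)
  define i where "i = inv_into D j"
  have ij: "i (j a) = a" if "a \<in> D" for a using j that by (simp add: i_def)
  have j0: "j a \<noteq> 0" for a by (simp add: j_def)
  define S where "S = insert 0 (j ` D)"
  \<comment> \<open>The absolute values matter only off the carrier, where distances must be nonnegative too.\<close>
  define d where "d = (\<lambda>k l. if k = l then 0 else if k = 0 then \<bar>f (i l)\<bar>
     else if l = 0 then \<bar>f (i k)\<bar> else mdist U (i k) (i l))"
  have dj: "d (j a) (j b) = mdist U a b" if "a \<in> D" "b \<in> D" for a b
    using that D(2) j by (auto simp: d_def ij j0 inj_on_eq_iff subset_iff)
  have d0: "d 0 (j a) = f a" "d (j a) 0 = f a" if "a \<in> D" for a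
    using that j0[of a] pos[OF that] by (auto simp: d_def ij)
  have d00: "d 0 0 = 0" by (simp add: d_def)
  have DU: "a \<in> mspace U" if "a \<in> D" for a using that D(2) by blast
  have MS: "Metric_space S d"
  proof
    fix k l show "0 \<le> d k l" by (simp add: d_def)
    show "d k l = d l k" by (simp add: d_def mdist_commute)
  next
    fix k l assume kl: "k \<in> S" "l \<in> S"
    consider "k = 0" "l = 0" | a where "k = 0" "a \<in> D" "l = j a" | a where "a \<in> D" "k = j a" "l = 0"
      | a b where "a \<in> D" "b \<in> D" "k = j a" "l = j b"
      using kl unfolding S_def by blast
    then show "d k l = 0 \<longleftrightarrow> k = l"
    proof cases
      case 1 then show ?thesis by (simp add: d00)
    next
      case 2 then show ?thesis using pos[OF 2(2)] j0[of a] by (simp add: d0)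
    next
      case 3 then show ?thesis using pos[OF 3(1)] j0[of a] by (simp add: d0)
    next
      case 4 then show ?thesis using j DU by (simp add: dj inj_on_eq_iff)
    qed
  next
    fix k l n assume S: "k \<in> S" "l \<in> S" "n \<in> S"
    have kat: "f a \<le> f b + mdist U a b" "f a \<le> f b + mdist U b a" "f a \<le> mdist U a b + f b"
      "f a \<le> mdist U b a + f b" "mdist U a b \<le> f a + f b" "0 \<le> f a" if "a \<in> D" "b \<in> D" for a b
      using katetovD[OF f that] katetov_nonneg[OF f that(1)] mdist_commute[of U a b] by simp_all
    show "d k n \<le> d k l + d l n"
      using S unfolding S_def
      by (elim insertE imageE) (simp_all add: dj d0 d00 kat DU mdist_triangle)
  qed
  define M' where "M' = metric (S, d)"
  interpret M: Metric_space S d by (rule MS)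
  have M': "mspace M' = S" "mdist M' = d" by (simp_all add: M'_def)
  have "isometric_embedding (submetric U D) M' j"
    using D(2) by (auto simp: isometric_embedding_def M' S_def dj)
  moreover have "finite (mspace M')" using D(1) by (simp add: M' S_def)
  ultimately obtain g where g: "isometric_embedding M' U g" "\<forall>a\<in>D. g (j a) = a"
    using conjunct2[OF U[unfolded urysohn_space_def], rule_format, of D M' j] D by blast
  have g0: "g 0 \<in> mspace U" using g(1) by (auto simp: isometric_embedding_def M' S_def)
  have "mdist U (g 0) a = f a" if "a \<in> D" for a
  proof -
    have "mdist U (g 0) (g (j a)) = d 0 (j a)"
      using g(1) that by (simp add: isometric_embedding_def M' S_def)
    then show ?thesis using g(2) that by (simp add: d0)
  qed
  then show ?thesis using that g0 by blast
qed

section \<open>A generic countable structure\<close>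

text \<open>A generic chain for countably many goals: stage \<open>n + 1\<close> meets goal \<open>n\<close> as soon as any extension of
stage \<open>n\<close> meets it. Since every later stage extends stage \<open>n\<close>, a goal that becomes attainable at
some later stage has been met as well.\<close>

lemma generic_chain:
  fixes ext :: "'s \<Rightarrow> 's \<Rightarrow> bool" and goal :: "nat \<Rightarrow> 's \<Rightarrow> bool"
  assumes refl: "\<And>x. ext x x" and trans: "\<And>x y z. ext x y \<Longrightarrow> ext y z \<Longrightarrow> ext x z" and s0: "I s0"
  obtains s where "s 0 = s0" "\<And>n. I (s n)" "\<And>i j. i \<le> j \<Longrightarrow> ext (s i) (s j)"
    "\<And>n t. I t \<Longrightarrow> ext (s n) t \<Longrightarrow> goal n t \<Longrightarrow> goal n (s (Suc n))"
proof -
  define ok where "ok = (\<lambda>n x y. I y \<and> ext x y \<and> ((\<exists>t. I t \<and> ext x t \<and> goal n t) \<longrightarrow> goal n y))"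
  have "\<exists>y. ok n x y" if "I x" for n x
    using that refl[of x] unfolding ok_def by (cases "\<exists>t. I t \<and> ext x t \<and> goal n t") blast+
  then have "\<forall>n x. \<exists>y. I x \<longrightarrow> ok n x y" by blast
  then obtain step where ok: "\<And>n x. I x \<Longrightarrow> ok n x (step n x)" by metis
  have step: "I (step n x)" "ext x (step n x)" "\<And>t. I t \<Longrightarrow> ext x t \<Longrightarrow> goal n t \<Longrightarrow> goal n (step n x)"
    if "I x" for n x using ok[OF that, of n] unfolding ok_def by blast+
  note stepE = step(2)
  define s where "s = rec_nat s0 step"
  have s0': "s 0 = s0" and s_Suc: "s (Suc n) = step n (s n)" for n by (simp_all add: s_def)
  have Is: "I (s n)" for n
    by (induction n) (simp_all add: s0' s_Suc s0 step)
  have "ext (s i) (s j)" if "i \<le> j" for i j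
    using that
  proof (induction rule: dec_induct)
    case base show ?case by (rule refl)
  next
    case (step n)
    show ?case unfolding s_Suc by (rule trans[OF step.IH stepE[OF Is]])
  qed
  moreover have "goal n (s (Suc n))" if "I t" "ext (s n) t" "goal n t" for n t
    unfolding s_Suc by (rule step(3)[OF Is that])
  ultimately show ?thesis using that[of s] s0' Is by blast
qed

lemma chain_union:
  fixes A :: "nat \<Rightarrow> 'a set"
  assumes "\<And>i j. i \<le> j \<Longrightarrow> A i \<subseteq> A j \<and> (\<forall>a\<in>A i. p j a = p i a)"
  obtains P where "\<And>n a. a \<in> A n \<Longrightarrow> P a = p n a"
proof (rule that)
  fix n :: nat and a assume a: "a \<in> A n"
  have "a \<in> A (LEAST n. a \<in> A n)" "(LEAST n. a \<in> A n) \<le> n" using a by (auto intro: LeastI Least_le)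
  then show "p (LEAST n. a \<in> A n) a = p n a" using assms by metis
qed

text \<open>Density of the generic structure rests on this lemma: the structure can be extended to any given
point \<open>c\<close> of the ambient space. The retraction must send \<open>c\<close> to a point \<open>q\<close> with
\<open>d q (Q a) \<le> d c a\<close> for all \<open>a\<close>, which in general is a new point. Its distances are those in the
space where \<open>q\<close> is joined to each \<open>Q a\<close> by an edge of length \<open>d c a\<close>, and \<open>\<delta> c\<close> is given the
largest value that the Lipschitz condition permits. The bound \<open>d c q \<le> 2 * \<delta> c\<close> then follows from
\<open>d a (Q a) \<le> 2 * \<delta> a\<close>.\<close>

lemma add_point:
  assumes U: "urysohn_space U" and S: "retraction_structure U D Q \<delta>" and fin: "finite D"
    and c: "c \<in> mspace U"
  obtains D' Q' \<delta>' where "retraction_structure U D' Q' \<delta>'" "finite D'" "D \<subseteq> D'" "c \<in> D'"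
    "\<And>a. a \<in> D \<Longrightarrow> Q' a = Q a" "\<And>a. a \<in> D \<Longrightarrow> \<delta>' a = \<delta> a"
proof (cases "D = {}")
  case True
  have "one_point_type U D Q \<delta> f None 0" for f
    using True by (simp add: one_point_type_def katetov_def)
  then show ?thesis
    by (rule realise_type[OF S _ c]) (use True that fin in auto)
next
  case False
  note SD = retraction_structureD[OF S]
  have com: "mdist U a b = mdist U b a" for a b by (rule mdist_commute)
  have QU: "Q a \<in> mspace U" if "a \<in> D" for a using SD(2,3) that by blast
  define h where "h = (\<lambda>v a. mdist U c a + mdist U (Q a) v)"
  define g where "g = (\<lambda>v. Min (h v ` D))"
  have g_le: "g v \<le> mdist U c a + mdist U (Q a) v" if "a \<in> D" for v a
    using that fin by (simp add: g_def h_def)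
  have g_at: "\<exists>a\<in>D. g v = mdist U c a + mdist U (Q a) v" for v
  proof -
    have "g v \<in> h v ` D" unfolding g_def using fin False by (intro Min_in) auto
    then show ?thesis by (auto simp: h_def)
  qed
  define r where "r = Min ((\<lambda>a. mdist U c a + \<delta> a) ` D)"
  have r_le: "r \<le> mdist U c a + \<delta> a" if "a \<in> D" for a
    using that fin by (simp add: r_def)
  have r_at: "\<exists>a\<in>D. r = mdist U c a + \<delta> a"
  proof -
    have "r \<in> (\<lambda>a. mdist U c a + \<delta> a) ` D" unfolding r_def using fin False by (intro Min_in) auto
    then show ?thesis by auto
  qed
  have gK: "katetov U (mspace U) g"
    unfolding katetov_def
  proof (intro ballI conjI)
    fix v w assume vw: "v \<in> mspace U" "w \<in> mspace U"
    obtain a where a: "a \<in> D" "g v = mdist U c a + mdist U (Q a) v" using g_at by blast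
    obtain b where b: "b \<in> D" "g w = mdist U c b + mdist U (Q b) w" using g_at by blast
    have "mdist U (Q b) v \<le> mdist U (Q b) w + mdist U w v"
      using vw QU b by (intro mdist_triangle) auto
    then show "g v \<le> g w + mdist U v w" using g_le[OF b(1), of v] b(2) com[of v w] by linarith
    have "mdist U v w \<le> mdist U v (Q a) + mdist U (Q a) w"
      "mdist U (Q a) w \<le> mdist U (Q a) (Q b) + mdist U (Q b) w"
      using vw QU a b by (auto intro!: mdist_triangle)
    moreover have "mdist U (Q a) (Q b) \<le> mdist U a b" using SD(6) a b by blast
    moreover have "mdist U a b \<le> mdist U a c + mdist U c b"
      using SD(2) a b c by (intro mdist_triangle) auto
    ultimately show "mdist U v w \<le> g v + g w"
      using a(2) b(2) com[of v "Q a"] com[of a c] by linarith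
  qed
  have sub: "insert c D \<subseteq> mspace U" using c SD(1) by blast
  \<comment> \<open>The point \<open>q\<close> has to be placed correctly relative to \<open>c\<close> before \<open>c\<close> joins the structure.\<close>
  obtain q where q: "q \<in> mspace U" "\<And>v. v \<in> insert c D \<Longrightarrow> mdist U q v = g v"
    using urysohn_one_point[OF U _ sub katetov_mono[OF gK sub]] fin by blast
  have T1: "one_point_type U D Q \<delta> g None 0"
  proof -
    have "g (Q a) \<le> g a" "\<delta> a \<le> g a" "0 \<le> g a" "0 \<le> \<delta> a" if a: "a \<in> D" for a
    proof -
      obtain b where b: "b \<in> D" "g a = mdist U c b + mdist U (Q b) a" using g_at by blast
      have "mdist U (Q b) (Q a) \<le> mdist U (Q b) a"
        using SD(6)[OF SD(3)[OF b(1)] a] retraction_structure_idem[OF S b(1)] by simp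
      then show "g (Q a) \<le> g a" using g_le[OF b(1), of "Q a"] b(2) by linarith
      have "\<delta> a \<le> \<delta> (Q b) + mdist U a (Q b)" using SD(3,7) a b by blast
      then show "\<delta> a \<le> g a" using SD(4)[OF b(1)] b(2) com[of a "Q b"] mdist_nonneg[of U c b] by linarith
      show "0 \<le> g a" using b(2) by simp
      show "0 \<le> \<delta> a" by (rule retraction_structure_nonneg[OF S a])
    qed
    then show ?thesis using katetov_mono[OF gK SD(1)] by (simp add: one_point_type_def)
  qed
  obtain Q1 \<delta>1 where S1: "retraction_structure U (insert q D) Q1 \<delta>1"
    and ag1: "\<And>a. a \<in> D \<Longrightarrow> Q1 a = Q a" "\<And>a. a \<in> D \<Longrightarrow> \<delta>1 a = \<delta> a"
    and q1: "Q1 q = q" "\<delta>1 q = 0"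
    by (rule realise_type[OF S T1 q(1)]) (use q in auto)
  have T2: "one_point_type U (insert q D) Q1 \<delta>1 (mdist U c) (Some q) r"
  proof -
    obtain b where b: "b \<in> D" "r = mdist U c b + \<delta> b" using r_at by blast
    have r0: "0 \<le> r" using b retraction_structure_nonneg[OF S b(1)] by simp
    have cq: "mdist U c q = g c" using q(2)[of c] com[of c q] by simp
    have "mdist U (Q b) c \<le> mdist U (Q b) b + mdist U b c"
      using b QU SD(2) c by (intro mdist_triangle) auto
    then have s: "mdist U c q \<le> 2 * r"
      using cq g_le[OF b(1), of c] b(2) SD(5)[OF b(1)] com[of b "Q b"] com[of b c] by linarith
    obtain a where a: "a \<in> D" "g c = mdist U c a + mdist U (Q a) c" using g_at by blast
    have rs: "r \<le> mdist U c q"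
      using r_le[OF SD(3)[OF a(1)]] SD(4)[OF a(1)] a(2) cq com[of c "Q a"] mdist_nonneg[of U c a]
      by linarith
    have "\<delta> v \<le> r + mdist U c v" if v: "v \<in> D" for v
    proof -
      have "mdist U v b \<le> mdist U v c + mdist U c b" using v b SD(2) c by (intro mdist_triangle) auto
      then show ?thesis using SD(7)[OF v b(1)] b(2) com[of v c] by linarith
    qed
    moreover have "mdist U q (Q v) \<le> mdist U c v" if v: "v \<in> D" for v
      using q(2)[of "Q v"] SD(3)[OF v] g_le[OF v, of "Q v"] QU[OF v] by simp
    moreover have "katetov U (insert q D) (mdist U c)"
      using q(1) SD(1) c by (intro katetov_mdist) auto
    ultimately show ?thesis
      using s rs r0 q1 ag1 r_le q(1) by (simp add: one_point_type_def add.commute)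
  qed
  obtain Q2 \<delta>2 where S2: "retraction_structure U (insert c (insert q D)) Q2 \<delta>2"
    and ag2: "\<And>a. a \<in> insert q D \<Longrightarrow> Q2 a = Q1 a" "\<And>a. a \<in> insert q D \<Longrightarrow> \<delta>2 a = \<delta>1 a"
    by (rule realise_type[OF S1 T2 c]) auto
  show ?thesis
    by (rule that[OF S2]) (use fin ag1 ag2 in auto)
qed

text \<open>Here \<open>f\<close> and \<open>g\<close> are the intended distances from \<open>x\<close> and from \<open>Q x\<close>. Recording the image only
through its distances treats points of the range, where \<open>g = f\<close>, and points over a given \<open>c\<close>,
where \<open>g\<close> is the distance from \<open>c\<close>, in the same way.\<close>

definition near_profile ::
  "'a metric \<Rightarrow> ('a \<Rightarrow> 'a) \<Rightarrow> ('a \<Rightarrow> real) \<Rightarrow> 'a set \<Rightarrow> ('a \<Rightarrow> real) \<Rightarrow> ('a \<Rightarrow> real) \<Rightarrow> real \<Rightarrow> real \<Rightarrow> 'a \<Rightarrow> bool"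
  where "near_profile m Q \<delta> A f g r e x \<longleftrightarrow>
     (\<forall>a\<in>A. \<bar>mdist m x a - f a\<bar> < e \<and> \<bar>mdist m (Q x) a - g a\<bar> < e) \<and> \<bar>\<delta> x - r\<bar> < e"

lemma near_rational:
  fixes x :: real assumes "e > 0" obtains q :: rat where "\<bar>x - of_rat q\<bar> < e"
proof -
  obtain q :: rat where "x - e < of_rat q" "of_rat q < x + e"
    using of_rat_dense[of "x - e" "x + e"] assms by auto
  then show ?thesis by (intro that[of q]) linarith
qed

text \<open>There are uncountably many one-point types, but up to any tolerance a finite part of a type is
described by finitely many indices into a dense sequence and rational numbers. Such descriptions,
together with the demand that each point of the dense sequence be added, form the countable list of
goals of a generic chain. The last clause expresses genericity: a profile that can be met, up to
\<open>e\<close>, by extending a suitable large stage is met within the union of the stages, up to \<open>6 * e\<close>.\<close>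

lemma generic_structure:
  assumes U: "urysohn_space U"
  obtains D Q \<delta> where "retraction_structure U D Q \<delta>" "dense_in U D"
    "\<And>A f g r e E. finite A \<Longrightarrow> A \<subseteq> mspace U \<Longrightarrow> e > 0 \<Longrightarrow> finite E \<Longrightarrow> E \<subseteq> D \<Longrightarrow>
       \<exists>C. finite C \<and> E \<subseteq> C \<and> C \<subseteq> D \<and> retraction_structure U C Q \<delta> \<and>
         (\<forall>C' Q' \<delta>' x. finite C' \<longrightarrow> C \<subseteq> C' \<longrightarrow> retraction_structure U C' Q' \<delta>' \<longrightarrow>
            (\<forall>a\<in>C. Q' a = Q a \<and> \<delta>' a = \<delta> a) \<longrightarrow> x \<in> C' \<longrightarrow> near_profile U Q' \<delta>' A f g r e x \<longrightarrow>
            (\<exists>y\<in>D. near_profile U Q \<delta> A f g r (6 * e) y))"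
proof -
  obtain x0 where "x0 \<in> mspace U"
    by (rule urysohn_one_point[OF U, of "{}" "\<lambda>_. 0"]) (auto simp: katetov_def)
  then obtain c :: "nat \<Rightarrow> 'a" where c: "dense_in U (range c)"
    using polish_dense_sequence[of U] U unfolding urysohn_space_def by blast
  have cU: "c i \<in> mspace U" for i using c by (auto simp: dense_in_def)
  define I where "I = (\<lambda>(D, Q, \<delta>). finite D \<and> retraction_structure U D Q \<delta>)"
  define ext where "ext = (\<lambda>(D, Q, \<delta>) (D', Q', \<delta>'). D \<subseteq> D' \<and>
     (\<forall>a\<in>D. (Q' :: 'a \<Rightarrow> 'a) a = Q a \<and> (\<delta>' :: 'a \<Rightarrow> real) a = \<delta> a))"
  define appr where "appr = (\<lambda>L r (t :: rat) Q \<delta> x.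
     (\<forall>(n, v, w) \<in> set L. \<bar>mdist U x (c n) - of_rat v\<bar> < of_rat t \<and>
        \<bar>mdist U (Q x :: 'a) (c n) - of_rat w\<bar> < of_rat t) \<and> \<bar>(\<delta> x :: real) - of_rat r\<bar> < of_rat t)"
  define goal where "goal = (\<lambda>k (D, Q, \<delta>).
     case (from_nat k :: nat + ((nat \<times> rat \<times> rat) list \<times> rat \<times> rat)) of
       Inl i \<Rightarrow> c i \<in> D | Inr (L, r, t) \<Rightarrow> \<exists>x\<in>D. appr L r t Q \<delta> x)"
  obtain s where s: "s 0 = ({}, \<lambda>x. x, \<lambda>x. 0)" "\<And>n. I (s n)" "\<And>i j. i \<le> j \<Longrightarrow> ext (s i) (s j)"
    "\<And>n t. I t \<Longrightarrow> ext (s n) t \<Longrightarrow> goal n t \<Longrightarrow> goal n (s (Suc n))"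
  proof (rule generic_chain[of ext I "({}, \<lambda>x. x, \<lambda>x. 0)" goal])
    show "ext x x" for x by (auto simp: ext_def)
    show "ext x z" if "ext x y" "ext y z" for x y z
      using that unfolding ext_def by (auto split: prod.splits)
    show "I ({}, \<lambda>x. x, \<lambda>x. 0)" by (simp add: I_def retraction_structure_def)
  qed blast
  define A where "A = (\<lambda>n. fst (s n))"
  define q where "q = (\<lambda>n. fst (snd (s n)))"
  define d where "d = (\<lambda>n. snd (snd (s n)))"
  have sn: "s n = (A n, q n, d n)" for n by (simp add: A_def q_def d_def)
  have An: "finite (A n)" "retraction_structure U (A n) (q n) (d n)" for n
    using s(2)[of n] by (simp_all add: sn I_def)
  have mono: "A i \<subseteq> A j \<and> (\<forall>a\<in>A i. q j a = q i a \<and> d j a = d i a)" if "i \<le> j" for i j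
    using s(3)[OF that] by (simp add: sn ext_def)
  obtain Q where Q: "\<And>n a. a \<in> A n \<Longrightarrow> Q a = q n a"
    using chain_union[of A q] mono by blast
  obtain \<delta> where \<delta>: "\<And>n a. a \<in> A n \<Longrightarrow> \<delta> a = d n a"
    using chain_union[of A d] mono by blast
  have struct: "retraction_structure U (A n) Q \<delta>" for n
    by (rule retraction_structure_cong[OF An(2)]) (use Q \<delta> in auto)
  define D where "D = (\<Union>n. A n)"
  have common: "\<exists>n\<ge>k. E \<subseteq> A n" if "finite E" "E \<subseteq> D" for E k
    using that
  proof (induction E)
    case empty then show ?case by auto
  next
    case (insert x E)
    then obtain n where n: "n \<ge> k" "E \<subseteq> A n" by auto
    obtain n' where "x \<in> A n'" using insert.prems by (auto simp: D_def)
    then have "insert x E \<subseteq> A (max n n')" using n mono[of n "max n n'"] mono[of n' "max n n'"] by auto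
    then show ?case using n by (intro exI[of _ "max n n'"]) auto
  qed
  have cD: "c i \<in> D" for i
  proof -
    define k where "k = to_nat (Inl i :: nat + ((nat \<times> rat \<times> rat) list \<times> rat \<times> rat))"
    obtain D' Q' \<delta>' where "retraction_structure U D' Q' \<delta>'" "finite D'" "A k \<subseteq> D'" "c i \<in> D'"
      "\<And>a. a \<in> A k \<Longrightarrow> Q' a = q k a" "\<And>a. a \<in> A k \<Longrightarrow> \<delta>' a = d k a"
      by (rule add_point[OF U An(2)[of k] An(1)[of k] cU[of i]]) blast
    then have "goal k (s (Suc k))"
      by (intro s(4)[of "(D', Q', \<delta>')"]) (auto simp: I_def ext_def sn goal_def k_def)
    then show ?thesis by (auto simp: goal_def sn k_def D_def)
  qed
  show ?thesis
  proof (rule that)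
    show S: "retraction_structure U D Q \<delta>"
      unfolding retraction_structure_def
    proof (intro conjI ballI)
      show "D \<subseteq> mspace U" using retraction_structureD(1)[OF struct] by (auto simp: D_def)
      fix x assume "x \<in> D"
      then obtain n where n: "x \<in> A n" by (auto simp: D_def)
      show "Q x \<in> D" "\<delta> (Q x) = 0" "mdist U x (Q x) \<le> 2 * \<delta> x"
        using retraction_structureD(3-5)[OF struct n] by (auto simp: D_def)
    next
      fix x y assume "x \<in> D" "y \<in> D"
      then obtain n where "{x, y} \<subseteq> A n" using common[of "{x, y}" 0] by auto
      then show "mdist U (Q x) (Q y) \<le> mdist U x y" "\<delta> x \<le> \<delta> y + mdist U x y"
        using retraction_structureD(6,7)[OF struct] by auto
    qed
    show "dense_in U D"
      using c cD retraction_structureD(1)[OF S] unfolding dense_in_def by blast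
    fix B :: "'a set" and f g :: "'a \<Rightarrow> real" and r e :: real and E
    assume B: "finite B" "B \<subseteq> mspace U" and e: "e > 0" and E: "finite E" "E \<subseteq> D"
    have "\<forall>a\<in>B. \<exists>n. mdist U a (c n) < e"
      using B e c unfolding dense_in_def by blast
    then obtain n where n: "\<And>a. a \<in> B \<Longrightarrow> mdist U a (c (n a)) < e" by metis
    have "\<exists>v :: rat. \<bar>x - of_rat v\<bar> < e" for x :: real using near_rational[OF e] by metis
    then obtain \<rho> :: "real \<Rightarrow> rat" where \<rho>: "\<And>x. \<bar>x - of_rat (\<rho> x)\<bar> < e" by metis
    \<comment> \<open>Moving the points of \<open>B\<close> into the dense sequence and rounding each cost at most \<open>e\<close>, on the
      way into the list of goals and again on the way back.\<close>
    obtain t :: rat where t: "3 * e < of_rat t" "of_rat t < 4 * e"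
      using of_rat_dense[of "3 * e" "4 * e"] e by auto
    obtain xs where xs: "set xs = B" using B finite_list by blast
    define L where "L = map (\<lambda>a. (n a, \<rho> (f a), \<rho> (g a))) xs"
    define k where "k = to_nat (Inr (L, \<rho> r, t) :: nat + ((nat \<times> rat \<times> rat) list \<times> rat \<times> rat))"
    have appr_iff: "appr L (\<rho> r) t Q' \<delta>' x \<longleftrightarrow> (\<forall>a\<in>B. \<bar>mdist U x (c (n a)) - of_rat (\<rho> (f a))\<bar> < of_rat t \<and>
        \<bar>mdist U (Q' x) (c (n a)) - of_rat (\<rho> (g a))\<bar> < of_rat t) \<and> \<bar>\<delta>' x - of_rat (\<rho> r)\<bar> < of_rat t"
      for Q' \<delta>' x by (auto simp: appr_def L_def xs)
    \<comment> \<open>The stage that must be extended may come much later than the stage \<open>k\<close> that handles this goal.\<close>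
    obtain j where j: "j \<ge> k" "E \<subseteq> A j" using common[OF E] by blast
    have close: "\<bar>mdist U x (c (n a)) - mdist U x a\<bar> < e" if "a \<in> B" "x \<in> mspace U" for a x
      using n[OF that(1)] mdist_triangle[of x U a "c (n a)"] mdist_triangle[of x U "c (n a)" a]
        that B cU mdist_commute[of U a "c (n a)"] by (auto simp: abs_if)
    show "\<exists>C. finite C \<and> E \<subseteq> C \<and> C \<subseteq> D \<and> retraction_structure U C Q \<delta> \<and>
         (\<forall>C' Q' \<delta>' x. finite C' \<longrightarrow> C \<subseteq> C' \<longrightarrow> retraction_structure U C' Q' \<delta>' \<longrightarrow>
            (\<forall>a\<in>C. Q' a = Q a \<and> \<delta>' a = \<delta> a) \<longrightarrow> x \<in> C' \<longrightarrow> near_profile U Q' \<delta>' B f g r e x \<longrightarrow>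
            (\<exists>y\<in>D. near_profile U Q \<delta> B f g r (6 * e) y))"
    proof (intro exI[of _ "A j"] conjI allI impI)
      show "finite (A j)" "E \<subseteq> A j" "A j \<subseteq> D" "retraction_structure U (A j) Q \<delta>"
        using An j struct by (auto simp: D_def)
      fix C' Q' \<delta>' x
      assume C': "finite C'" "A j \<subseteq> C'" "retraction_structure U C' Q' \<delta>'"
        "\<forall>a\<in>A j. Q' a = Q a \<and> \<delta>' a = \<delta> a" "x \<in> C'" and near: "near_profile U Q' \<delta>' B f g r e x"
      have xU: "x \<in> mspace U" "Q' x \<in> mspace U" using retraction_structureD(2,3)[OF C'(3)] C'(5) by blast+
      have "appr L (\<rho> r) t Q' \<delta>' x"
        unfolding appr_iff
      proof (intro conjI ballI)
        fix a assume a: "a \<in> B"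
        then have "\<bar>mdist U x a - f a\<bar> < e" "\<bar>mdist U (Q' x) a - g a\<bar> < e"
          using near by (auto simp: near_profile_def)
        then show "\<bar>mdist U x (c (n a)) - of_rat (\<rho> (f a))\<bar> < of_rat t"
          "\<bar>mdist U (Q' x) (c (n a)) - of_rat (\<rho> (g a))\<bar> < of_rat t"
          using close[OF a xU(1)] close[OF a xU(2)] \<rho>[of "f a"] \<rho>[of "g a"] t by linarith+
      next
        show "\<bar>\<delta>' x - of_rat (\<rho> r)\<bar> < of_rat t"
          using near \<rho>[of r] t e unfolding near_profile_def by linarith
      qed
      moreover have "ext (s k) (C', Q', \<delta>')"
        using mono[OF j(1)] C' Q \<delta> by (auto simp: sn ext_def)
      ultimately have "goal k (s (Suc k))"
        using C' by (intro s(4)[of "(C', Q', \<delta>')"]) (auto simp: I_def goal_def k_def)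
      then obtain y where y: "y \<in> A (Suc k)" "appr L (\<rho> r) t (q (Suc k)) (d (Suc k)) y"
        by (auto simp: goal_def sn k_def)
      then have app: "appr L (\<rho> r) t Q \<delta> y" using Q \<delta> unfolding appr_def by simp
      have yD: "y \<in> D" using y(1) by (auto simp: D_def)
      then have yU: "y \<in> mspace U" "Q y \<in> mspace U" using retraction_structureD(2,3)[OF S] by blast+
      have "near_profile U Q \<delta> B f g r (6 * e) y"
        unfolding near_profile_def
      proof (intro conjI ballI)
        fix a assume a: "a \<in> B"
        then have "\<bar>mdist U y (c (n a)) - of_rat (\<rho> (f a))\<bar> < of_rat t"
          "\<bar>mdist U (Q y) (c (n a)) - of_rat (\<rho> (g a))\<bar> < of_rat t"
          using app by (auto simp: appr_iff)
        then show "\<bar>mdist U y a - f a\<bar> < 6 * e" "\<bar>mdist U (Q y) a - g a\<bar> < 6 * e"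
          using close[OF a yU(1)] close[OF a yU(2)] \<rho>[of "f a"] \<rho>[of "g a"] t by linarith+
      next
        show "\<bar>\<delta> y - r\<bar> < 6 * e" using app \<rho>[of r] t e unfolding appr_iff by linarith
      qed
      then show "\<exists>y\<in>D. near_profile U Q \<delta> B f g r (6 * e) y" using yD by blast
    qed
  qed
qed

section \<open>The extension property\<close>

text \<open>The conditions on a retraction structure are closed and \<open>Q\<close>, \<open>\<delta>\<close> are \<open>1\<close>-Lipschitz, so they pass
from a dense set to the whole space.\<close>

lemma structure_extension:
  assumes S: "retraction_structure U D Q \<delta>" and D: "dense_in U D" and U: "fast_complete U"
  obtains Q' \<delta>' where "retraction_structure U (mspace U) Q' \<delta>'"
    "\<And>a. a \<in> D \<Longrightarrow> Q' a = Q a" "\<And>a. a \<in> D \<Longrightarrow> \<delta>' a = \<delta> a"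
proof -
  note SD = retraction_structureD[OF S]
  have com: "mdist U a b = mdist U b a" for a b by (rule mdist_commute)
  have "Q a \<in> mspace U" if "a \<in> D" for a using SD(2,3) that by blast
  then obtain Q' where Q': "\<And>x. x \<in> mspace U \<Longrightarrow> Q' x \<in> mspace U"
    "\<And>x y. x \<in> mspace U \<Longrightarrow> y \<in> mspace U \<Longrightarrow> mdist U (Q' x) (Q' y) \<le> mdist U x y"
    "\<And>a. a \<in> D \<Longrightarrow> Q' a = Q a"
    by (rule lipschitz_extension[OF D U, of Q]) (use SD(6) in blast)+
  have lip: "\<bar>\<delta> a - \<delta> b\<bar> \<le> mdist U a b" if "a \<in> D" "b \<in> D" for a b
    using SD(7)[OF that] SD(7)[OF that(2) that(1)] com[of a b] by linarith
  obtain \<delta>' where \<delta>'0: "\<And>x. x \<in> mspace U \<Longrightarrow> \<delta>' x \<in> mspace (euclidean_metric :: real metric)"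
    "\<And>x y. x \<in> mspace U \<Longrightarrow> y \<in> mspace U \<Longrightarrow> mdist euclidean_metric (\<delta>' x) (\<delta>' y) \<le> mdist U x y"
    "\<And>a. a \<in> D \<Longrightarrow> \<delta>' a = \<delta> a"
    by (rule lipschitz_extension[OF D fast_complete_real, of \<delta>]) (auto simp: dist_real_def lip)
  have \<delta>': "\<bar>\<delta>' x - \<delta>' y\<bar> \<le> mdist U x y" if "x \<in> mspace U" "y \<in> mspace U" for x y
    using \<delta>'0(2)[OF that] by (simp add: dist_real_def)
  have "retraction_structure U (mspace U) Q' \<delta>'"
    unfolding retraction_structure_def
  proof (intro conjI ballI)
    fix x assume x: "x \<in> mspace U"
    show "Q' x \<in> mspace U" by (rule Q'(1)[OF x])
    have "\<bar>\<delta>' (Q' x)\<bar> \<le> 0"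
    proof (rule le_if_le_add_multiple[of 1])
      fix e :: real assume e: "e > 0"
      obtain a where a: "a \<in> D" "a \<in> mspace U" "mdist U x a < e" by (rule dense_inE[OF D x e])
      have "\<delta>' (Q' a) = 0" using Q'(3) \<delta>'0(3) SD(3,4) a by simp
      moreover have "\<bar>\<delta>' (Q' x) - \<delta>' (Q' a)\<bar> \<le> mdist U (Q' x) (Q' a)" using \<delta>' Q'(1) x a by blast
      moreover have "mdist U (Q' x) (Q' a) \<le> mdist U x a" using Q'(2) x a by blast
      ultimately show "\<bar>\<delta>' (Q' x)\<bar> \<le> 0 + 1 * e" using a(3) by linarith
    qed simp
    then show "\<delta>' (Q' x) = 0" by simp
    show "mdist U x (Q' x) \<le> 2 * \<delta>' x"
    proof (rule le_if_le_add_multiple[of 4])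
      fix e :: real assume e: "e > 0"
      obtain a where a: "a \<in> D" "a \<in> mspace U" "mdist U x a < e" by (rule dense_inE[OF D x e])
      have "mdist U x (Q' x) \<le> mdist U x a + mdist U a (Q' x)"
        "mdist U a (Q' x) \<le> mdist U a (Q' a) + mdist U (Q' a) (Q' x)"
        using x a Q'(1) by (auto intro!: mdist_triangle)
      moreover have "mdist U (Q' a) (Q' x) \<le> mdist U a x" using Q'(2) x a by blast
      moreover have "mdist U a (Q' a) \<le> 2 * \<delta>' a" using Q'(3) \<delta>'0(3) SD(5) a by simp
      ultimately show "mdist U x (Q' x) \<le> 2 * \<delta>' x + 4 * e"
        using \<delta>'[OF x a(2)] a(3) com[of a x] by linarith
    qed simp
  next
    fix x y assume xy: "x \<in> mspace U" "y \<in> mspace U"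
    show "mdist U (Q' x) (Q' y) \<le> mdist U x y" by (rule Q'(2)[OF xy])
    show "\<delta>' x \<le> \<delta>' y + mdist U x y" using \<delta>'[OF xy] by linarith
  qed simp
  then show ?thesis using that Q'(3) \<delta>'0(3) by blast
qed

definition image_profile :: "'a metric \<Rightarrow> ('a \<Rightarrow> real) \<Rightarrow> 'a option \<Rightarrow> 'a \<Rightarrow> real" where
  "image_profile m f q a = (case q of None \<Rightarrow> f a | Some c \<Rightarrow> mdist m c a)"

text \<open>A type over the whole space is transferred to the generic countable structure. For \<open>Some c\<close> the
point \<open>c\<close> need not belong to that structure and is replaced by a nearby point \<open>c'\<close> of the range
that does; enlarging \<open>f\<close> and \<open>r\<close> by the distance that is allowed between \<open>c\<close> and \<open>c'\<close> restores
all inequalities of a type.\<close>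

lemma approximate_realisation:
  assumes U: "urysohn_space U"
  obtains Q \<delta> where "retraction_structure U (mspace U) Q \<delta>"
    "\<And>f q r A e. one_point_type U (mspace U) Q \<delta> f q r \<Longrightarrow> finite A \<Longrightarrow> A \<subseteq> mspace U \<Longrightarrow> e > 0 \<Longrightarrow>
       \<exists>y\<in>mspace U. near_profile U Q \<delta> A f (image_profile U f q) r e y"
proof -
  have com: "mdist U a b = mdist U b a" for a b by (rule mdist_commute)
  obtain D Q0 \<delta>0 where S0: "retraction_structure U D Q0 \<delta>0" and D: "dense_in U D" and
    gen: "\<And>A f g r e E. finite A \<Longrightarrow> A \<subseteq> mspace U \<Longrightarrow> e > 0 \<Longrightarrow> finite E \<Longrightarrow> E \<subseteq> D \<Longrightarrow>
       \<exists>C. finite C \<and> E \<subseteq> C \<and> C \<subseteq> D \<and> retraction_structure U C Q0 \<delta>0 \<and>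
         (\<forall>C' Q' \<delta>' x. finite C' \<longrightarrow> C \<subseteq> C' \<longrightarrow> retraction_structure U C' Q' \<delta>' \<longrightarrow>
            (\<forall>a\<in>C. Q' a = Q0 a \<and> \<delta>' a = \<delta>0 a) \<longrightarrow> x \<in> C' \<longrightarrow> near_profile U Q' \<delta>' A f g r e x \<longrightarrow>
            (\<exists>y\<in>D. near_profile U Q0 \<delta>0 A f g r (6 * e) y))"
    by (rule generic_structure[OF U]) blast
  have DU: "D \<subseteq> mspace U" using D by (auto simp: dense_in_def)
  have "fast_complete U"
    using U fast_complete_if_mcomplete unfolding urysohn_space_def polish_metric_def by blast
  then obtain Q \<delta> where S: "retraction_structure U (mspace U) Q \<delta>"
    and ag: "\<And>a. a \<in> D \<Longrightarrow> Q a = Q0 a" "\<And>a. a \<in> D \<Longrightarrow> \<delta> a = \<delta>0 a"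
    by (rule structure_extension[OF S0 D]) blast
  note SD = retraction_structureD[OF S]
  \<comment> \<open>The primed data are a perturbation of the profile that is a type over every large stage of
    the generic structure; its new point is placed metrically over \<open>A\<close> as well, although \<open>A\<close>
    may lie outside the stage.\<close>
  have step: "\<exists>y\<in>mspace U. near_profile U Q \<delta> A f g r (6 * e) y"
    if K: "katetov U (mspace U) f'" and E: "finite E" "E \<subseteq> D"
      and T: "\<And>C. E \<subseteq> C \<Longrightarrow> C \<subseteq> D \<Longrightarrow> one_point_type U C Q \<delta> f' q' r'"
      and A: "finite A" "A \<subseteq> mspace U" and e: "e > 0"
      and ap: "\<And>a. a \<in> A \<Longrightarrow> \<bar>f' a - f a\<bar> < e" "\<And>a. a \<in> A \<Longrightarrow> \<bar>image_profile U f' q' a - g a\<bar> < e" "\<bar>r' - r\<bar> < e"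
    for A f g r e E f' q' r'
  proof -
    obtain C where C: "finite C" "E \<subseteq> C" "C \<subseteq> D" "retraction_structure U C Q0 \<delta>0"
      and CC: "\<And>C' Q' \<delta>' x. finite C' \<Longrightarrow> C \<subseteq> C' \<Longrightarrow> retraction_structure U C' Q' \<delta>' \<Longrightarrow>
            (\<forall>a\<in>C. Q' a = Q0 a \<and> \<delta>' a = \<delta>0 a) \<Longrightarrow> x \<in> C' \<Longrightarrow> near_profile U Q' \<delta>' A f g r e x \<Longrightarrow>
            \<exists>y\<in>D. near_profile U Q0 \<delta>0 A f g r (6 * e) y"
      using gen[OF A e E, of f g r] by blast
    have AC: "finite (A \<union> C)" "A \<union> C \<subseteq> mspace U" using A C DU by auto
    obtain x where x: "x \<in> mspace U" "\<And>a. a \<in> A \<union> C \<Longrightarrow> mdist U x a = f' a"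
      using urysohn_one_point[OF U AC katetov_mono[OF K AC(2)]] by blast
    have T0: "one_point_type U C Q0 \<delta>0 f' q' r'"
      by (rule one_point_type_cong[OF T[OF C(2,3)]]) (use ag C in auto)
    obtain Q' \<delta>' where S': "retraction_structure U (insert x C) Q' \<delta>'"
      and ag': "\<And>a. a \<in> C \<Longrightarrow> Q' a = Q0 a" "\<And>a. a \<in> C \<Longrightarrow> \<delta>' a = \<delta>0 a"
      and x': "Q' x = image_point q' x" "\<delta>' x = r'"
      by (rule realise_type[OF C(4) T0 x(1)]) (use x(2) in auto)
    have "mdist U (Q' x) a = image_profile U f' q' a" if "a \<in> A" for a
      using x(2) that x'(1) by (cases q') (auto simp: image_profile_def)
    then have "near_profile U Q' \<delta>' A f g r e x"
      using ap x x' unfolding near_profile_def by auto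
    then have "\<exists>y\<in>D. near_profile U Q0 \<delta>0 A f g r (6 * e) y"
      by (intro CC[OF _ _ S']) (use C ag' in auto)
    then show ?thesis using DU ag unfolding near_profile_def by (metis subsetD)
  qed
  show ?thesis
  proof (rule that[OF S])
    fix f q r A and e :: real
    assume T: "one_point_type U (mspace U) Q \<delta> f q r" and A: "finite A" "A \<subseteq> mspace U" and e: "e > 0"
    have e6: "6 * (e / 6) = e" by simp
    have K: "katetov U (mspace U) f" using T by (simp add: one_point_type_def)
    show "\<exists>y\<in>mspace U. near_profile U Q \<delta> A f (image_profile U f q) r e y"
    proof (cases q)
      case None
      have "one_point_type U C Q \<delta> f q r" if "C \<subseteq> D" for C
        by (rule one_point_type_mono[OF T]) (use that DU None in auto)
      then have "\<exists>y\<in>mspace U. near_profile U Q \<delta> A f (image_profile U f q) r (6 * (e / 6)) y"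
        by (intro step[OF K, of "{}" q r]) (use A e in auto)
      then show ?thesis unfolding e6 .
    next
      case (Some c)
      define h where "h = e / 12"
      have h: "h > 0" "h < e / 6" using e by (auto simp: h_def)
      have c: "c \<in> mspace U" "\<delta> c = 0" "f c \<le> 2 * r" "\<And>a. a \<in> mspace U \<Longrightarrow> mdist U c (Q a) \<le> f a"
        using T Some by (auto simp: one_point_type_def)
      have rd: "r \<le> \<delta> a + f a" "\<delta> a \<le> r + f a" if "a \<in> mspace U" for a
        using T that by (auto simp: one_point_type_def)
      have Qc: "Q c = c" by (rule retraction_structure_fixed[OF S c(1,2)])
      obtain b where b: "b \<in> D" "b \<in> mspace U" "mdist U c b < h" by (rule dense_inE[OF D c(1) h(1)])
      define c' where "c' = Q b"
      have c'D: "c' \<in> D" using retraction_structureD(3)[OF S0 b(1)] ag b by (simp add: c'_def)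
      have c'U: "c' \<in> mspace U" using c'D DU by blast
      have c'0: "\<delta> c' = 0" using SD(4) b by (simp add: c'_def)
      have cc': "mdist U c c' < h" using SD(6)[OF c(1) b(2)] Qc b(3) by (simp add: c'_def)
      have near_c: "\<bar>mdist U c' a - mdist U c a\<bar> < h" if "a \<in> mspace U" for a
        using mdist_triangle[of c' U c a] mdist_triangle[of c U c' a] cc' com[of c c'] that c(1) c'U
        by linarith
      have K': "katetov U (mspace U) (\<lambda>v. f v + h)"
        unfolding katetov_def
      proof (intro ballI conjI)
        fix a b assume ab: "a \<in> mspace U" "b \<in> mspace U"
        show "f a + h \<le> f b + h + mdist U a b" "mdist U a b \<le> f a + h + (f b + h)"
          using katetovD[OF K ab] h by linarith+
      qed
      have T': "one_point_type U (mspace U) Q \<delta> (\<lambda>v. f v + h) (Some c') (r + h)"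
      proof -
        have "f c' \<le> f c + h"
          using katetovD(1)[OF K c'U c(1)] com[of c c'] cc' by linarith
        then have "f c' + h \<le> 2 * (r + h)"
          using c(3) by (simp add: distrib_left)
        moreover have "r + h \<le> \<delta> a + (f a + h) \<and> \<delta> a \<le> r + h + (f a + h) \<and> mdist U c' (Q a) \<le> f a + h"
          if a: "a \<in> mspace U" for a
          using rd[OF a] c(4)[OF a] near_c[OF SD(3)[OF a]] h by linarith
        ultimately show ?thesis using K' c'U c'0 by (simp add: one_point_type_def)
      qed
      have T'': "one_point_type U C Q \<delta> (\<lambda>v. f v + h) (Some c') (r + h)" if "{c'} \<subseteq> C" "C \<subseteq> D" for C
        by (rule one_point_type_mono[OF T']) (use that DU in auto)
      have "\<bar>image_profile U (\<lambda>v. f v + h) (Some c') a - image_profile U f q a\<bar> < e / 6" if "a \<in> A" for a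
        using near_c[of a] that A h by (simp add: image_profile_def Some subset_iff)
      then have "\<exists>y\<in>mspace U. near_profile U Q \<delta> A f (image_profile U f q) r (6 * (e / 6)) y"
        by (intro step[OF K', of "{c'}" "Some c'" "r + h"]) (use T'' A e h c'D in auto)
      then show ?thesis unfolding e6 .
    qed
  qed
qed

text \<open>The free extension: the new point is joined to the larger structure only through \<open>A\<close>. Closedness of
\<open>A\<close> under \<open>Q\<close> enters for types of points of the range, where \<open>f (Q a) \<le> f a\<close> must be inherited.\<close>

lemma type_extension:
  assumes S: "retraction_structure m D Q \<delta>" and A: "finite A" "A \<noteq> {}" "A \<subseteq> D" "Q ` A \<subseteq> A"
    and T: "one_point_type m A Q \<delta> f q r"
  obtains F where "one_point_type m D Q \<delta> F q r" "\<And>a. a \<in> A \<Longrightarrow> F a = f a"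
    "\<And>v. \<exists>a\<in>A. F v = f a + mdist m a v"
proof -
  note SD = retraction_structureD[OF S]
  have com: "mdist m a b = mdist m b a" for a b by (rule mdist_commute)
  have K: "katetov m A f" using T by (simp add: one_point_type_def)
  define F where "F = (\<lambda>v. Min ((\<lambda>a. f a + mdist m a v) ` A))"
  have F_le: "F v \<le> f a + mdist m a v" if "a \<in> A" for v a
    using that A by (simp add: F_def)
  have F_at: "\<exists>a\<in>A. F v = f a + mdist m a v" for v
  proof -
    have "F v \<in> (\<lambda>a. f a + mdist m a v) ` A" unfolding F_def using A by (intro Min_in) auto
    then show ?thesis by auto
  qed
  have AM: "a \<in> mspace m" if "a \<in> A" for a using that A(3) SD(1) by blast
  have FK: "katetov m D F"
    unfolding katetov_def
  proof (intro ballI conjI)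
    fix v w assume vw: "v \<in> D" "w \<in> D"
    obtain a where a: "a \<in> A" "F v = f a + mdist m a v" using F_at by blast
    obtain b where b: "b \<in> A" "F w = f b + mdist m b w" using F_at by blast
    note in_m = AM[OF a(1)] AM[OF b(1)] SD(2)[OF vw(1)] SD(2)[OF vw(2)]
    have "mdist m b v \<le> mdist m b w + mdist m w v" using in_m by (simp add: mdist_triangle)
    then show "F v \<le> F w + mdist m v w" using F_le[OF b(1), of v] b(2) com[of v w] by linarith
    have "mdist m v w \<le> mdist m v a + mdist m a w" "mdist m a w \<le> mdist m a b + mdist m b w"
      using in_m by (simp_all add: mdist_triangle)
    then show "mdist m v w \<le> F v + F w"
      using a(2) b(2) katetovD(2)[OF K a(1) b(1)] com[of v a] by linarith
  qed
  have "F a = f a" if a: "a \<in> A" for a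
  proof (rule antisym)
    show "F a \<le> f a" using F_le[OF a, of a] AM[OF a] by simp
    obtain b where "b \<in> A" "F a = f b + mdist m b a" using F_at by blast
    then show "f a \<le> F a" using katetovD(1)[OF K a, of b] com[of a b] by simp
  qed
  moreover have "one_point_type m D Q \<delta> F q r"
  proof -
    have "r \<le> \<delta> v + F v \<and> \<delta> v \<le> r + F v" if v: "v \<in> D" for v
    proof -
      obtain a where a: "a \<in> A" "F v = f a + mdist m a v" using F_at by blast
      have aD: "a \<in> D" using a A by blast
      have "r \<le> \<delta> a + f a" "\<delta> a \<le> r + f a" using T a(1) by (auto simp: one_point_type_def)
      then show ?thesis using SD(7)[OF aD v] SD(7)[OF v aD] a(2) com[of v a] by linarith
    qed
    moreover have "r = 0 \<and> (\<forall>v\<in>D. F (Q v) \<le> F v)" if q: "q = None"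
    proof (intro conjI ballI)
      show "r = 0" using T q by (simp add: one_point_type_def)
      fix v assume v: "v \<in> D"
      obtain a where a: "a \<in> A" "F v = f a + mdist m a v" using F_at by blast
      have "f (Q a) \<le> f a" using T q a(1) by (simp add: one_point_type_def)
      moreover have "F (Q v) \<le> f (Q a) + mdist m (Q a) (Q v)" using F_le A(4) a(1) by blast
      moreover have "mdist m (Q a) (Q v) \<le> mdist m a v" using SD(6) v a A(3) by blast
      ultimately show "F (Q v) \<le> F v" using a(2) by linarith
    qed
    moreover have "c \<in> D \<and> \<delta> c = 0 \<and> F c \<le> 2 * r \<and> (\<forall>v\<in>D. mdist m c (Q v) \<le> F v)" if q: "q = Some c" for c
    proof -
      have c: "c \<in> A" "\<delta> c = 0" "f c \<le> 2 * r" "\<And>a. a \<in> A \<Longrightarrow> mdist m c (Q a) \<le> f a"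
        using T q by (auto simp: one_point_type_def)
      have "mdist m c (Q v) \<le> F v" if v: "v \<in> D" for v
      proof -
        obtain a where a: "a \<in> A" "F v = f a + mdist m a v" using F_at by blast
        have aD: "a \<in> D" using a A by blast
        have "mdist m c (Q v) \<le> mdist m c (Q a) + mdist m (Q a) (Q v)"
          using AM[OF c(1)] SD(2,3) aD v by (simp add: mdist_triangle)
        then show ?thesis using c(4)[OF a(1)] SD(6)[OF aD v] a(2) by linarith
      qed
      then show ?thesis using c A(3) \<open>\<And>a. a \<in> A \<Longrightarrow> F a = f a\<close> by auto
    qed
    ultimately show ?thesis using FK by (cases q) (auto simp: one_point_type_def)
  qed
  ultimately show ?thesis using that F_at by blast
qed

text \<open>An exact realisation may be sought close to an approximate one: if \<open>x\<close> fits a type up to an error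
\<open>e\<close>, then the new point can in addition be joined to \<open>x\<close> by an edge of length \<open>e\<close> without
violating any condition on the type.\<close>

lemma type_near_approximation:
  assumes S: "retraction_structure m D Q \<delta>" and T: "one_point_type m D Q \<delta> F q r" and x: "x \<in> D"
    and e: "e \<ge> 0" "\<And>v. v \<in> D \<Longrightarrow> mdist m x v \<le> F v + e" "\<bar>\<delta> x - r\<bar> \<le> e"
    and q: "case q of None \<Rightarrow> Q x = x | Some c \<Rightarrow> mdist m (Q x) c \<le> e"
  shows "one_point_type m D Q \<delta> (\<lambda>v. min (F v) (e + mdist m x v)) q r"
proof -
  note SD = retraction_structureD[OF S]
  have com: "mdist m a b = mdist m b a" for a b by (rule mdist_commute)
  have K: "katetov m D F" using T by (simp add: one_point_type_def)
  let ?F = "\<lambda>v. min (F v) (e + mdist m x v)"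
  have "katetov m D ?F"
    unfolding katetov_def
  proof (intro ballI conjI)
    fix v w assume vw: "v \<in> D" "w \<in> D"
    have tri: "mdist m x v \<le> mdist m x w + mdist m v w" "mdist m v w \<le> mdist m x v + mdist m x w"
      using katetovD[OF katetov_mdist[OF SD(1) SD(2)[OF x]] vw] by auto
    show "?F v \<le> ?F w + mdist m v w" using katetovD(1)[OF K vw] tri by linarith
    have "mdist m v w \<le> F v + (e + mdist m x w)" "mdist m v w \<le> F w + (e + mdist m x v)"
      using e(2)[OF vw(1)] e(2)[OF vw(2)] tri by linarith+
    then show "mdist m v w \<le> ?F v + ?F w" using katetovD(2)[OF K vw] tri e(1) by linarith
  qed
  moreover have "r \<le> \<delta> v + ?F v \<and> \<delta> v \<le> r + ?F v" if v: "v \<in> D" for v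
  proof -
    have "r \<le> \<delta> v + F v" "\<delta> v \<le> r + F v" using T v by (auto simp: one_point_type_def)
    then show ?thesis using SD(7)[OF x v] SD(7)[OF v x] e(3) com[of x v] by linarith
  qed
  moreover have "?F (Q v) \<le> ?F v" if "q = None" "v \<in> D" for v
  proof -
    have "F (Q v) \<le> F v" using T that by (auto simp: one_point_type_def)
    moreover have "mdist m x (Q v) \<le> mdist m x v" using SD(6)[OF x that(2)] q that(1) by simp
    ultimately show ?thesis by linarith
  qed
  moreover have "mdist m c (Q v) \<le> ?F v" if c: "q = Some c" and v: "v \<in> D" for c v
  proof -
    have "mdist m c (Q v) \<le> F v" "c \<in> D" using T that by (auto simp: one_point_type_def)
    moreover have "mdist m c (Q v) \<le> mdist m c (Q x) + mdist m (Q x) (Q v)"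
      using SD(2,3) x v \<open>c \<in> D\<close> by (simp add: mdist_triangle)
    moreover have "mdist m c (Q x) \<le> e" using q c com[of c "Q x"] by simp
    ultimately show ?thesis using SD(6)[OF x v] by linarith
  qed
  ultimately show ?thesis using T by (cases q) (auto simp: one_point_type_def)
qed

text \<open>The analogue for retraction structures of the one-point extension property that characterises the
Urysohn space.\<close>

definition extension_property :: "'a metric \<Rightarrow> ('a \<Rightarrow> 'a) \<Rightarrow> ('a \<Rightarrow> real) \<Rightarrow> bool" where
  "extension_property U Q \<delta> \<longleftrightarrow>
     (\<forall>A f q r. finite A \<and> A \<subseteq> mspace U \<and> Q ` A \<subseteq> A \<and> one_point_type U A Q \<delta> f q r \<longrightarrow>
        (\<exists>x\<in>mspace U. (\<forall>a\<in>A. mdist U x a = f a) \<and> Q x = image_point q x \<and> \<delta> x = r))"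

lemma extension_propertyE:
  assumes "extension_property U Q \<delta>" "one_point_type U A Q \<delta> f q r"
    and "finite A" "A \<subseteq> mspace U" "Q ` A \<subseteq> A"
  obtains x where "x \<in> mspace U" "\<And>a. a \<in> A \<Longrightarrow> mdist U x a = f a" "Q x = image_point q x" "\<delta> x = r"
  using assms(1)[unfolded extension_property_def, rule_format, of A f q r] assms(2-) by blast

text \<open>Approximate realisations with halving errors are chosen one after the other, each near its
predecessor, and converge to an exact realisation. Each step applies approximate realisation to the
type that also prescribes a small distance to the previous point.\<close>

lemma exact_realisation:
  assumes S: "retraction_structure U (mspace U) Q \<delta>" and U: "fast_complete U" "mspace U \<noteq> {}"
    and approx: "\<And>f q r A e. one_point_type U (mspace U) Q \<delta> f q r \<Longrightarrow> finite A \<Longrightarrow> A \<subseteq> mspace U \<Longrightarrow> e > 0 \<Longrightarrow>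
       \<exists>y\<in>mspace U. near_profile U Q \<delta> A f (image_profile U f q) r e y"
  shows "extension_property U Q \<delta>"
  unfolding extension_property_def
proof (intro allI impI, elim conjE)
  fix A f q r
  assume A: "finite A" "A \<subseteq> mspace U" "Q ` A \<subseteq> A" and T: "one_point_type U A Q \<delta> f q r"
  note SD = retraction_structureD[OF S]
  have com: "mdist U a b = mdist U b a" for a b by (rule mdist_commute)
  show "\<exists>x\<in>mspace U. (\<forall>a\<in>A. mdist U x a = f a) \<and> Q x = image_point q x \<and> \<delta> x = r"
  proof (cases "A = {}")
    case True
    then have "q = None" "r = 0" using T by (auto simp: one_point_type_def split: option.splits)
    moreover obtain x where "x \<in> mspace U" using U(2) by blast
    ultimately show ?thesis using True SD(3,4) retraction_structure_idem[OF S]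
      by (intro bexI[of _ "Q x"]) auto
  next
    case False
    obtain F where F: "one_point_type U (mspace U) Q \<delta> F q r" "\<And>a. a \<in> A \<Longrightarrow> F a = f a"
      "\<And>v. \<exists>a\<in>A. F v = f a + mdist U a v"
      by (rule type_extension[OF S A(1) False A(2,3) T]) blast
    define good where "good = (\<lambda>e x. x \<in> mspace U \<and> (\<forall>a\<in>A. \<bar>mdist U x a - f a\<bar> \<le> e) \<and>
      \<bar>\<delta> x - r\<bar> \<le> e \<and> (case q of None \<Rightarrow> Q x = x | Some c \<Rightarrow> mdist U (Q x) c \<le> e))"
    have approx_good: "\<exists>y. good e y \<and> (\<forall>b\<in>B. \<bar>mdist U y b - G b\<bar> \<le> e)"
      if G: "one_point_type U (mspace U) Q \<delta> G q r" "\<And>a. a \<in> A \<Longrightarrow> G a = f a"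
        and B: "finite B" "A \<subseteq> B" "B \<subseteq> mspace U" and e: "e > 0" for G B e
    proof -
      obtain y where y: "y \<in> mspace U" and near: "near_profile U Q \<delta> B G (image_profile U G q) r e y"
        using approx[OF G(1) B(1,3) e] by blast
      show ?thesis
      proof (cases q)
        case None
        \<comment> \<open>The point \<open>y\<close> is only close to the range; its image lies in it and fits as well.\<close>
        then have r: "r = 0" using T by (simp add: one_point_type_def)
        have close: "\<bar>mdist U (Q y) b - G b\<bar> \<le> e" if "b \<in> B" for b
          using near None that unfolding near_profile_def image_profile_def by fastforce
        have "\<bar>mdist U (Q y) a - f a\<bar> \<le> e" if "a \<in> A" for a
          using close[of a] G(2)[OF that] that B(2) by auto
        then have "good e (Q y)"
          using None r SD(3,4)[OF y] retraction_structure_idem[OF S y] e by (simp add: good_def)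
        then show ?thesis using close by blast
      next
        case (Some c)
        then have "c \<in> A" using T by (simp add: one_point_type_def)
        then have "c \<in> B" "c \<in> mspace U" using B A by auto
        then have "mdist U (Q y) c < e"
          using near Some unfolding near_profile_def image_profile_def by fastforce
        moreover have close: "\<bar>mdist U y b - G b\<bar> \<le> e" if "b \<in> B" for b
          using near that unfolding near_profile_def by fastforce
        moreover have "\<bar>mdist U y a - f a\<bar> \<le> e" if "a \<in> A" for a
          using close[of a] G(2)[OF that] that B(2) by auto
        moreover have "\<bar>\<delta> y - r\<bar> \<le> e" using near by (simp add: near_profile_def)
        ultimately have "good e y" using y Some by (simp add: good_def)
        then show ?thesis using close by blast
      qed
    qed
    have improve: "\<exists>y. good (e / 2) y \<and> mdist U x y \<le> e + e / 2" if x: "good e x" and e: "e > 0" for e x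
    proof -
      let ?G = "\<lambda>v. min (F v) (e + mdist U x v)"
      have xU: "x \<in> mspace U" using x by (simp add: good_def)
      have "mdist U x v \<le> F v + e" if v: "v \<in> mspace U" for v
      proof -
        obtain a where a: "a \<in> A" "F v = f a + mdist U a v" using F(3) by blast
        have "\<bar>mdist U x a - f a\<bar> \<le> e" using x a(1) by (simp add: good_def)
        moreover have "mdist U x v \<le> mdist U x a + mdist U a v"
          using xU v a(1) A(2) by (intro mdist_triangle) auto
        ultimately show ?thesis using a(2) by linarith
      qed
      then have G: "one_point_type U (mspace U) Q \<delta> ?G q r"
        by (intro type_near_approximation[OF S F(1) xU]) (use x e in \<open>auto simp: good_def\<close>)
      have "?G a = f a" if a: "a \<in> A" for a
      proof -
        have "\<bar>mdist U x a - f a\<bar> \<le> e" using x a by (simp add: good_def)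
        then show ?thesis using F(2)[OF a] by simp
      qed
      then obtain y where y: "good (e / 2) y" "\<forall>b\<in>insert x A. \<bar>mdist U y b - ?G b\<bar> \<le> e / 2"
        using approx_good[OF G, of "insert x A" "e / 2"] A xU e by auto
      have "\<bar>mdist U y x - ?G x\<bar> \<le> e / 2" using y(2) by blast
      moreover have "?G x \<le> e" using xU by simp
      ultimately have "mdist U x y \<le> e + e / 2" using com[of x y] by linarith
      then show ?thesis using y(1) by blast
    qed
    \<comment> \<open>The factor \<open>1/4\<close> makes successive distances at most \<open>(1/2) ^ n\<close>.\<close>
    define e where "e = (\<lambda>n :: nat. (1/2 :: real) ^ n / 4)"
    have e: "e n > 0" "e (Suc n) = e n / 2" "e n + e n / 2 \<le> (1/2) ^ n" for n by (simp_all add: e_def)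
    have "\<exists>y. good (e 0) y" using approx_good[OF F(1,2) A(1) _ A(2) e(1)[of 0]] by blast
    moreover have "\<exists>y. good (e (Suc n)) y \<and> mdist U x y \<le> e n + e n / 2" if "good (e n) x" for x n
      unfolding e(2) by (rule improve[OF that e(1)])
    ultimately have "\<exists>s. \<forall>n. good (e n) (s n) \<and> mdist U (s n) (s (Suc n)) \<le> e n + e n / 2"
      by (rule dependent_nat_choice)
    then obtain s where s: "\<And>n. good (e n) (s n)" "\<And>n. mdist U (s n) (s (Suc n)) \<le> e n + e n / 2"
      by blast
    have sU: "s n \<in> mspace U" for n using s(1)[of n] by (simp add: good_def)
    have "mdist U (s n) (s (Suc n)) \<le> (1/2) ^ n" for n using s(2)[of n] e(3)[of n] by linarith
    then obtain l where l: "l \<in> mspace U" "(\<lambda>n. mdist U (s n) l) \<longlonglongrightarrow> 0"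
      by (rule fast_completeD[OF U(1) sU]) blast
    have "e \<longlonglongrightarrow> 0"
    proof -
      have "(\<lambda>n. (1/2 :: real) ^ n / 4) \<longlonglongrightarrow> 0 / 4"
        by (intro tendsto_divide LIMSEQ_power_zero tendsto_const) auto
      then show ?thesis by (simp add: e_def)
    qed
    then have "(\<lambda>n. 2 * mdist U (s n) l + 2 * e n) \<longlonglongrightarrow> 2 * 0 + 2 * 0"
      by (intro tendsto_mult tendsto_add tendsto_const l)
    then have zero: "x \<le> 0" if "\<And>n. x \<le> 2 * mdist U (s n) l + 2 * e n" for x
      using LIMSEQ_le_const[of _ 0 x] that by auto
    have sl: "mdist U (s n) l \<ge> 0" "e n \<ge> 0" for n using e(1)[of n] by auto
    have "mdist U l a = f a" if a: "a \<in> A" for a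
    proof -
      have aU: "a \<in> mspace U" using a A by blast
      have "\<bar>mdist U l a - f a\<bar> \<le> 2 * mdist U (s n) l + 2 * e n" for n
      proof -
        have "\<bar>mdist U (s n) a - f a\<bar> \<le> e n" using s(1)[of n] a by (simp add: good_def)
        moreover have "mdist U (s n) a \<le> mdist U (s n) l + mdist U l a"
          "mdist U l a \<le> mdist U l (s n) + mdist U (s n) a"
          using aU l(1) sU by (simp_all add: mdist_triangle)
        ultimately show ?thesis using com[of l "s n"] sl[of n] by linarith
      qed
      from zero[OF this] show ?thesis by simp
    qed
    moreover have "\<delta> l = r"
    proof -
      have "\<bar>\<delta> l - r\<bar> \<le> 2 * mdist U (s n) l + 2 * e n" for n
      proof -
        have "\<bar>\<delta> (s n) - r\<bar> \<le> e n" using s(1)[of n] by (simp add: good_def)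
        then show ?thesis
          using SD(7)[OF l(1) sU[of n]] SD(7)[OF sU[of n] l(1)] com[of l "s n"] sl[of n] by linarith
      qed
      from zero[OF this] show ?thesis by simp
    qed
    moreover have "Q l = image_point q l"
    proof -
      have Ql: "Q l \<in> mspace U" using SD(3) l(1) by blast
      have ip: "image_point q l \<in> mspace U"
        using l(1) F(1) by (cases q) (auto simp: one_point_type_def)
      have "mdist U (Q l) (image_point q l) \<le> 2 * mdist U (s n) l + 2 * e n" for n
      proof -
        have Qs: "Q (s n) \<in> mspace U" using SD(3) sU by blast
        have "mdist U (Q l) (image_point q l) \<le> mdist U (Q l) (Q (s n)) + mdist U (Q (s n)) (image_point q l)"
          using Ql Qs ip by (rule mdist_triangle)
        moreover have "mdist U (Q l) (Q (s n)) \<le> mdist U l (s n)" using SD(6) l(1) sU by blast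
        moreover have "mdist U (Q (s n)) (image_point q l) = mdist U (s n) l \<or>
            mdist U (Q (s n)) (image_point q l) \<le> e n"
          using s(1)[of n] by (cases q) (auto simp: good_def)
        ultimately show ?thesis using com[of l "s n"] sl[of n] by linarith
      qed
      from zero[OF this] have "mdist U (Q l) (image_point q l) = 0" using mdist_nonneg by (metis order_antisym)
      then show ?thesis using Ql ip by simp
    qed
    ultimately show ?thesis using l(1) by blast
  qed
qed

lemma generic_retraction_structure:
  assumes U: "urysohn_space U"
  obtains Q \<delta> where "retraction_structure U (mspace U) Q \<delta>" "extension_property U Q \<delta>"
proof -
  obtain x where "x \<in> mspace U"
    by (rule urysohn_one_point[OF U, of "{}" "\<lambda>_. 0"]) (auto simp: katetov_def)
  then have ne: "mspace U \<noteq> {}" by blast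
  have complete: "fast_complete U"
    using U fast_complete_if_mcomplete unfolding urysohn_space_def polish_metric_def by blast
  obtain Q \<delta> where S: "retraction_structure U (mspace U) Q \<delta>"
    and approx: "\<And>f q r A e. one_point_type U (mspace U) Q \<delta> f q r \<Longrightarrow> finite A \<Longrightarrow> A \<subseteq> mspace U \<Longrightarrow> e > 0 \<Longrightarrow>
       \<exists>y\<in>mspace U. near_profile U Q \<delta> A f (image_profile U f q) r e y"
    by (rule approximate_realisation[OF U]) blast
  show ?thesis by (rule that[OF S exact_realisation[OF S complete ne approx]])
qed

section \<open>Back and forth\<close>

text \<open>The domain is closed under the retraction, so that commuting with the retractions is meaningful, and
\<open>\<delta>\<close> is preserved as a part of the structure, because a finite domain does not determine the
distance to the range. With \<open>Q\<close> the identity and \<open>\<delta> = 0\<close> these are the finite partial isometries.\<close>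

definition finite_partial_iso ::
  "'a metric \<Rightarrow> ('a \<Rightarrow> 'a) \<Rightarrow> ('a \<Rightarrow> real) \<Rightarrow> 'b metric \<Rightarrow> ('b \<Rightarrow> 'b) \<Rightarrow> ('b \<Rightarrow> real) \<Rightarrow>
     'a set \<Rightarrow> ('a \<Rightarrow> 'b) \<Rightarrow> bool" where
  "finite_partial_iso m Q \<delta> m' Q' \<delta>' A p \<longleftrightarrow>
     finite A \<and> A \<subseteq> mspace m \<and>
     (\<forall>a\<in>A. Q a \<in> A \<and> p a \<in> mspace m' \<and> p (Q a) = Q' (p a) \<and> \<delta>' (p a) = \<delta> a \<and>
       (\<forall>b\<in>A. mdist m' (p a) (p b) = mdist m a b))"

lemma finite_partial_isoD:
  assumes "finite_partial_iso m Q \<delta> m' Q' \<delta>' A p"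
  shows "finite A" "A \<subseteq> mspace m" "a \<in> A \<Longrightarrow> a \<in> mspace m" "a \<in> A \<Longrightarrow> Q a \<in> A" "a \<in> A \<Longrightarrow> p a \<in> mspace m'"
    "a \<in> A \<Longrightarrow> p (Q a) = Q' (p a)" "a \<in> A \<Longrightarrow> \<delta>' (p a) = \<delta> a"
    "a \<in> A \<Longrightarrow> b \<in> A \<Longrightarrow> mdist m' (p a) (p b) = mdist m a b"
  using assms unfolding finite_partial_iso_def by auto

lemma finite_partial_iso_empty: "finite_partial_iso m Q \<delta> m' Q' \<delta>' {} p"
  by (simp add: finite_partial_iso_def)

lemma finite_partial_iso_inj:
  assumes P: "finite_partial_iso m Q \<delta> m' Q' \<delta>' A p"
  shows "inj_on p A"
proof (rule inj_onI)
  fix a b assume ab: "a \<in> A" "b \<in> A" "p a = p b"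
  then have "mdist m a b = 0" using finite_partial_isoD(8)[OF P, of a b] finite_partial_isoD(5)[OF P, of b] by simp
  then show "a = b" using finite_partial_isoD(3)[OF P] ab by simp
qed

lemma finite_partial_iso_inverse:
  assumes P: "finite_partial_iso m Q \<delta> m' Q' \<delta>' A p"
  shows "finite_partial_iso m' Q' \<delta>' m Q \<delta> (p ` A) (inv_into A p)"
proof -
  note PD = finite_partial_isoD[OF P]
  have i: "inv_into A p (p a) = a" if "a \<in> A" for a using finite_partial_iso_inj[OF P] that by simp
  have "Q' (p a) \<in> p ` A" "inv_into A p (Q' (p a)) = Q a" if "a \<in> A" for a
    using PD(4,6)[OF that] i[OF PD(4)[OF that]] by (metis image_eqI)+
  then show ?thesis
    using PD unfolding finite_partial_iso_def by (auto simp: i)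
qed

lemma finite_partial_iso_insert:
  assumes P: "finite_partial_iso m Q \<delta> m' Q' \<delta>' A p" and x: "x \<in> mspace m"
    and z: "z \<in> mspace m'" "\<And>a. a \<in> A \<Longrightarrow> mdist m' z (p a) = mdist m x a" "\<delta>' z = \<delta> x"
    and Q: "Q x = x \<and> Q' z = z \<or> Q x \<in> A \<and> Q' z = p (Q x)"
  obtains p' where "finite_partial_iso m Q \<delta> m' Q' \<delta>' (insert x A) p'" "\<And>a. a \<in> A \<Longrightarrow> p' a = p a"
proof (cases "x \<in> A")
  case True
  then show ?thesis using that[of p] P by (simp add: insert_absorb)
next
  case xA: False
  note PD = finite_partial_isoD[OF P]
  let ?p = "p(x := z)"
  have ag: "?p a = p a" if "a \<in> A" for a using that xA by auto
  have com: "mdist m' (p a) z = mdist m a x" if "a \<in> A" for a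
    using z(2)[OF that] mdist_commute[of m' "p a" z] mdist_commute[of m a x] by simp
  have "finite_partial_iso m Q \<delta> m' Q' \<delta>' (insert x A) ?p"
    unfolding finite_partial_iso_def
  proof (intro conjI ballI)
    show "finite (insert x A)" "insert x A \<subseteq> mspace m" using PD x by auto
    fix a assume a: "a \<in> insert x A"
    show "Q a \<in> insert x A" "?p a \<in> mspace m'" "\<delta>' (?p a) = \<delta> a"
      using a Q z PD ag by auto
    show "?p (Q a) = Q' (?p a)"
    proof (cases "a = x")
      case True then show ?thesis using Q ag xA by auto
    next
      case False then show ?thesis using a ag PD by auto
    qed
    fix b assume b: "b \<in> insert x A"
    show "mdist m' (?p a) (?p b) = mdist m a b"
      using a b z x PD(8) com xA by auto
  qed
  then show ?thesis using that ag by blast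
qed

lemma katetov_transport:
  assumes P: "finite_partial_iso m Q \<delta> m' Q' \<delta>' A p" and x: "x \<in> mspace m"
  shows "katetov m' (p ` A) (\<lambda>b. mdist m x (inv_into A p b))"
proof -
  note PD = finite_partial_isoD[OF P]
  have i: "inv_into A p (p a) = a" if "a \<in> A" for a using finite_partial_iso_inj[OF P] that by simp
  have "katetov m A (mdist m x)" using PD x by (intro katetov_mdist) auto
  then show ?thesis using PD(8) by (auto simp: katetov_def i)
qed

text \<open>The half of the back-and-forth condition that extends domains; the other half is the same condition
with the two structures exchanged.\<close>

definition forth ::
  "'a metric \<Rightarrow> ('a \<Rightarrow> 'a) \<Rightarrow> ('a \<Rightarrow> real) \<Rightarrow> 'b metric \<Rightarrow> ('b \<Rightarrow> 'b) \<Rightarrow> ('b \<Rightarrow> real) \<Rightarrow> bool" where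
  "forth m Q \<delta> m' Q' \<delta>' \<longleftrightarrow>
     (\<forall>A p x. finite_partial_iso m Q \<delta> m' Q' \<delta>' A p \<and> x \<in> mspace m \<longrightarrow>
        (\<exists>A' p'. finite_partial_iso m Q \<delta> m' Q' \<delta>' A' p' \<and> A \<subseteq> A' \<and> x \<in> A' \<and> (\<forall>a\<in>A. p' a = p a)))"

text \<open>The instance for plain metric spaces, used to compare the Urysohn space with the range of the
retraction.\<close>

lemma forth_if_katetov_realised:
  assumes "\<And>A f. finite A \<Longrightarrow> A \<subseteq> mspace m' \<Longrightarrow> katetov m' A f \<Longrightarrow>
    \<exists>z\<in>mspace m'. \<forall>a\<in>A. mdist m' z a = f a"
  shows "forth m (\<lambda>x. x) (\<lambda>_. 0) m' (\<lambda>x. x) (\<lambda>_. 0)"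
  unfolding forth_def
proof (intro allI impI, elim conjE)
  fix A p x assume P: "finite_partial_iso m (\<lambda>x. x) (\<lambda>_. 0) m' (\<lambda>x. x) (\<lambda>_. 0) A p" and x: "x \<in> mspace m"
  note PD = finite_partial_isoD[OF P]
  have i: "inv_into A p (p a) = a" if "a \<in> A" for a using finite_partial_iso_inj[OF P] that by simp
  have "\<exists>z\<in>mspace m'. \<forall>b\<in>p ` A. mdist m' z b = mdist m x (inv_into A p b)"
    using PD by (intro assms katetov_transport[OF P x]) auto
  then obtain z where "z \<in> mspace m'" "\<And>a. a \<in> A \<Longrightarrow> mdist m' z (p a) = mdist m x a" using i by auto
  then obtain p' where "finite_partial_iso m (\<lambda>x. x) (\<lambda>_. 0) m' (\<lambda>x. x) (\<lambda>_. 0) (insert x A) p'"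
    "\<And>a. a \<in> A \<Longrightarrow> p' a = p a"
    by (rule finite_partial_iso_insert[OF P x]) auto
  then show "\<exists>A' p'. finite_partial_iso m (\<lambda>x. x) (\<lambda>_. 0) m' (\<lambda>x. x) (\<lambda>_. 0) A' p' \<and>
      A \<subseteq> A' \<and> x \<in> A' \<and> (\<forall>a\<in>A. p' a = p a)"
    by (intro exI[of _ "insert x A"] exI[of _ p']) auto
qed

text \<open>The source is an arbitrary retraction structure, not merely one with the extension property; this
is what gives universality. A point \<open>x\<close> is added after its image \<open>Q x\<close>, and the type of each over
the current domain is carried over to the image of the domain.\<close>

lemma forth_if_extension_property:
  assumes S: "retraction_structure m (mspace m) Q \<delta>"
    and S': "retraction_structure m' (mspace m') Q' \<delta>'" and ext: "extension_property m' Q' \<delta>'"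
  shows "forth m Q \<delta> m' Q' \<delta>'"
proof -
  note SD = retraction_structureD[OF S] and SD' = retraction_structureD[OF S']
  have step: "\<exists>p'. finite_partial_iso m Q \<delta> m' Q' \<delta>' (insert x A) p' \<and> (\<forall>a\<in>A. p' a = p a)"
    if P: "finite_partial_iso m Q \<delta> m' Q' \<delta>' A p" and x: "x \<in> mspace m" and Qx: "Q x = x \<or> Q x \<in> A" for A p x
  proof -
    note PD = finite_partial_isoD[OF P]
    have i: "inv_into A p (p a) = a" if "a \<in> A" for a using finite_partial_iso_inj[OF P] that by simp
    define f where "f = (\<lambda>b. mdist m x (inv_into A p b))"
    have f: "f (p a) = mdist m x a" "f (Q' (p a)) = mdist m x (Q a)" if "a \<in> A" for a
      using i PD(4,6)[OF that] that by (auto simp: f_def) (metis i)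
    define q where "q = (if Q x = x then None else Some (p (Q x)))"
    have "one_point_type m' (p ` A) Q' \<delta>' f q (\<delta> x)"
    proof -
      have "\<delta> x \<le> \<delta>' b + f b \<and> \<delta>' b \<le> \<delta> x + f b" if b: "b \<in> p ` A" for b
      proof -
        obtain a where a: "a \<in> A" "b = p a" using b by blast
        then show ?thesis
          using SD(7)[OF x PD(3)[OF a(1)]] SD(7)[OF PD(3)[OF a(1)] x] f PD(7) mdist_commute[of m x a] by simp
      qed
      moreover have "\<delta> x = 0 \<and> (\<forall>b\<in>p ` A. f (Q' b) \<le> f b)" if "Q x = x"
      proof (intro conjI ballI)
        show "\<delta> x = 0" using SD(4)[OF x] that by simp
        fix b assume "b \<in> p ` A"
        then obtain a where a: "a \<in> A" "b = p a" by blast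
        then show "f (Q' b) \<le> f b" using f SD(6)[OF x PD(3)[OF a(1)]] that by simp
      qed
      moreover have "p (Q x) \<in> p ` A \<and> \<delta>' (p (Q x)) = 0 \<and> f (p (Q x)) \<le> 2 * \<delta> x \<and>
          (\<forall>b\<in>p ` A. mdist m' (p (Q x)) (Q' b) \<le> f b)" if "Q x \<noteq> x"
      proof (intro conjI ballI)
        have QA: "Q x \<in> A" using Qx that by simp
        then show "p (Q x) \<in> p ` A" by blast
        show "\<delta>' (p (Q x)) = 0" using PD(7)[OF QA] SD(4)[OF x] by simp
        show "f (p (Q x)) \<le> 2 * \<delta> x" using f(1)[OF QA] SD(5)[OF x] by simp
        fix b assume "b \<in> p ` A"
        then obtain a where a: "a \<in> A" "b = p a" by blast
        then have "mdist m' (p (Q x)) (Q' b) = mdist m (Q x) (Q a)"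
          using PD(8)[OF QA PD(4)[OF a(1)]] PD(6)[OF a(1)] by simp
        then show "mdist m' (p (Q x)) (Q' b) \<le> f b" using f(1) a SD(6)[OF x PD(3)[OF a(1)]] by simp
      qed
      ultimately show ?thesis
        using katetov_transport[OF P x] unfolding one_point_type_def q_def f_def[symmetric] by simp
    qed
    moreover have "finite (p ` A)" "p ` A \<subseteq> mspace m'" "Q' ` p ` A \<subseteq> p ` A"
      using PD(1,4,5) by (auto simp: PD(6)[symmetric])
    ultimately obtain z where z: "z \<in> mspace m'" "\<And>b. b \<in> p ` A \<Longrightarrow> mdist m' z b = f b"
      "Q' z = image_point q z" "\<delta>' z = \<delta> x"
      by (rule extension_propertyE[OF ext]) blast
    obtain p' where "finite_partial_iso m Q \<delta> m' Q' \<delta>' (insert x A) p'" "\<And>a. a \<in> A \<Longrightarrow> p' a = p a"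
      by (rule finite_partial_iso_insert[OF P x z(1) _ z(4)]) (use z f Qx in \<open>auto simp: q_def split: if_splits\<close>)
    then show ?thesis by blast
  qed
  show ?thesis
    unfolding forth_def
  proof (intro allI impI, elim conjE)
    fix A p x assume P: "finite_partial_iso m Q \<delta> m' Q' \<delta>' A p" and x: "x \<in> mspace m"
    obtain p1 where p1: "finite_partial_iso m Q \<delta> m' Q' \<delta>' (insert (Q x) A) p1" "\<forall>a\<in>A. p1 a = p a"
      using step[OF P, of "Q x"] SD(3)[OF x] retraction_structure_idem[OF S x] by blast
    obtain p2 where p2: "finite_partial_iso m Q \<delta> m' Q' \<delta>' (insert x (insert (Q x) A)) p2"
      "\<forall>a\<in>insert (Q x) A. p2 a = p1 a"
      using step[OF p1(1) x] by blast
    show "\<exists>A' p'. finite_partial_iso m Q \<delta> m' Q' \<delta>' A' p' \<and> A \<subseteq> A' \<and> x \<in> A' \<and> (\<forall>a\<in>A. p' a = p a)"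
      by (rule exI[of _ "insert x (insert (Q x) A)"], rule exI[of _ p2]) (use p1 p2 in auto)
  qed
qed

text \<open>A generic chain of finite partial isomorphisms whose domains exhaust a dense set has a limit, which
commutes with the retractions and preserves \<open>\<delta>\<close> by continuity. The additional goals make it
possible to steer the chain: none are needed for embeddings, while for isomorphisms they exhaust a
dense set of the target.\<close>

lemma generic_embedding:
  fixes m :: "'a metric" and m' :: "'b metric" and goal :: "nat \<Rightarrow> 'a set \<Rightarrow> ('a \<Rightarrow> 'b) \<Rightarrow> bool"
  assumes S: "retraction_structure m (mspace m) Q \<delta>" and c: "dense_in m (range (c :: nat \<Rightarrow> 'a))"
    and S': "retraction_structure m' (mspace m') Q' \<delta>'" and m': "fast_complete m'"
    and forth: "forth m Q \<delta> m' Q' \<delta>'" and P: "finite_partial_iso m Q \<delta> m' Q' \<delta>' A0 p0"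
    and goal: "\<And>n A p. finite_partial_iso m Q \<delta> m' Q' \<delta>' A p \<Longrightarrow>
      \<exists>A' p'. finite_partial_iso m Q \<delta> m' Q' \<delta>' A' p' \<and> A \<subseteq> A' \<and> (\<forall>a\<in>A. p' a = p a) \<and> goal n A' p'"
  obtains h where "isometric_embedding m m' h"
    "\<And>x. x \<in> mspace m \<Longrightarrow> Q' (h x) = h (Q x)" "\<And>x. x \<in> mspace m \<Longrightarrow> \<delta>' (h x) = \<delta> x"
    "\<And>a. a \<in> A0 \<Longrightarrow> h a = p0 a"
    "\<And>n. \<exists>A p. finite_partial_iso m Q \<delta> m' Q' \<delta>' A p \<and> goal n A p \<and> (\<forall>a\<in>A. h a = p a)"
proof -
  note SD = retraction_structureD[OF S] and SD' = retraction_structureD[OF S']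
  define I where "I = (\<lambda>(A, p). finite_partial_iso m Q \<delta> m' Q' \<delta>' A p)"
  define ext where "ext = (\<lambda>(A, p) (A', p'). A \<subseteq> A' \<and> (\<forall>a\<in>A. (p' :: 'a \<Rightarrow> 'b) a = p a))"
  \<comment> \<open>Even steps exhaust the dense sequence of the source, odd steps serve the additional goals.\<close>
  define G where "G = (\<lambda>n (A, p). if even n then c (n div 2) \<in> A else goal (n div 2) A p)"
  obtain s where s: "s 0 = (A0, p0)" "\<And>n. I (s n)" "\<And>i j. i \<le> j \<Longrightarrow> ext (s i) (s j)"
    "\<And>n t. I t \<Longrightarrow> ext (s n) t \<Longrightarrow> G n t \<Longrightarrow> G n (s (Suc n))"
  proof (rule generic_chain[of ext I "(A0, p0)" G])
    show "ext x x" for x by (auto simp: ext_def)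
    show "ext x z" if "ext x y" "ext y z" for x y z
      using that unfolding ext_def by (auto split: prod.splits)
    show "I (A0, p0)" using P by (simp add: I_def)
  qed blast
  define A where "A = (\<lambda>n. fst (s n))"
  define p where "p = (\<lambda>n. snd (s n))"
  have sn: "s n = (A n, p n)" for n by (simp add: A_def p_def)
  have fpi: "finite_partial_iso m Q \<delta> m' Q' \<delta>' (A n) (p n)" for n
    using s(2)[of n] by (simp add: sn I_def)
  note PD = finite_partial_isoD[OF fpi]
  have mono: "A i \<subseteq> A j \<and> (\<forall>a\<in>A i. p j a = p i a)" if "i \<le> j" for i j
    using s(3)[OF that] by (simp add: sn ext_def)
  obtain h0 where h0: "\<And>n a. a \<in> A n \<Longrightarrow> h0 a = p n a"
    using chain_union[of A p] mono by blast
  have cU: "c i \<in> mspace m" for i using c by (auto simp: dense_in_def)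
  have G: "G n (s (Suc n))" for n
  proof (cases "even n")
    case True
    obtain A' p' where "finite_partial_iso m Q \<delta> m' Q' \<delta>' A' p'" "A n \<subseteq> A'" "c (n div 2) \<in> A'" "\<forall>a\<in>A n. p' a = p n a"
      using forth fpi[of n] cU unfolding forth_def by meson
    then show ?thesis using True by (intro s(4)[of "(A', p')"]) (auto simp: I_def ext_def sn G_def)
  next
    case False
    obtain A' p' where "finite_partial_iso m Q \<delta> m' Q' \<delta>' A' p'" "A n \<subseteq> A'" "\<forall>a\<in>A n. p' a = p n a" "goal (n div 2) A' p'"
      using goal[OF fpi[of n]] by meson
    then show ?thesis using False by (intro s(4)[of "(A', p')"]) (auto simp: I_def ext_def sn G_def)
  qed
  define D where "D = (\<Union>n. A n)"
  have cD: "c i \<in> D" for i using G[of "2 * i"] by (auto simp: G_def sn D_def)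
  have D: "dense_in m D"
    unfolding dense_in_def
  proof (intro conjI ballI allI impI)
    show "D \<subseteq> mspace m" using PD(2) by (auto simp: D_def)
    fix x and e :: real assume "x \<in> mspace m" "e > 0"
    then obtain a where "a \<in> range c" "mdist m x a < e" by (rule dense_inE[OF c])
    then show "\<exists>a\<in>D. mdist m x a < e" using cD by auto
  qed
  have common: "\<exists>n. a \<in> A n \<and> b \<in> A n" if ab: "a \<in> D" "b \<in> D" for a b
  proof -
    obtain i j where "a \<in> A i" "b \<in> A j" using ab by (auto simp: D_def)
    then have "a \<in> A (max i j)" "b \<in> A (max i j)" using mono[of i "max i j"] mono[of j "max i j"] by auto
    then show ?thesis by blast
  qed
  have h0m: "h0 a \<in> mspace m'" if "a \<in> D" for a using that h0 PD(5) by (auto simp: D_def)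
  have h0d: "mdist m' (h0 a) (h0 b) = mdist m a b" if "a \<in> D" "b \<in> D" for a b
    using common[OF that] h0 PD(8) by metis
  obtain h where h: "isometric_embedding m m' h" "\<And>a. a \<in> D \<Longrightarrow> h a = h0 a"
    by (rule isometric_extension[OF D m' h0m h0d]) blast+
  have hm: "h x \<in> mspace m'" if "x \<in> mspace m" for x
    using h(1) that by (auto simp: isometric_embedding_def)
  have hd: "mdist m' (h x) (h y) = mdist m x y" if "x \<in> mspace m" "y \<in> mspace m" for x y
    using h(1) that by (auto simp: isometric_embedding_def)
  have hp: "h a = p n a" if "a \<in> A n" for a n using h(2)[of a] h0[OF that] that by (auto simp: D_def)
  show ?thesis
  proof (rule that[OF h(1)])
    fix x assume x: "x \<in> mspace m"
    have Qx: "Q x \<in> mspace m" by (rule SD(3)[OF x])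
    have "mdist m' (Q' (h x)) (h (Q x)) \<le> 0"
    proof (rule le_if_le_add_multiple[of 2])
      fix e :: real assume e: "e > 0"
      obtain a where a: "a \<in> D" "a \<in> mspace m" "mdist m x a < e" by (rule dense_inE[OF D x e])
      obtain n where n: "a \<in> A n" using a by (auto simp: D_def)
      have eq: "h (Q a) = Q' (h a)" using hp PD(4,6) n by metis
      have "mdist m' (Q' (h x)) (h (Q x)) \<le> mdist m' (Q' (h x)) (Q' (h a)) + mdist m' (Q' (h a)) (h (Q x))"
        using SD'(3) hm x a Qx by (intro mdist_triangle) auto
      moreover have "mdist m' (Q' (h x)) (Q' (h a)) \<le> mdist m x a" using SD'(6) hm hd x a by metis
      moreover have "mdist m' (Q' (h a)) (h (Q x)) \<le> mdist m x a"
        unfolding eq[symmetric] using hd[OF SD(3)[OF a(2)] Qx] SD(6)[OF a(2) x] mdist_commute[of m a x] by simp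
      ultimately show "mdist m' (Q' (h x)) (h (Q x)) \<le> 0 + 2 * e" using a(3) by linarith
    qed simp
    then have "mdist m' (Q' (h x)) (h (Q x)) = 0" using mdist_nonneg by (metis order_antisym)
    then show "Q' (h x) = h (Q x)" using SD'(3) hm x Qx by simp
    have "\<bar>\<delta>' (h x) - \<delta> x\<bar> \<le> 0"
    proof (rule le_if_le_add_multiple[of 2])
      fix e :: real assume e: "e > 0"
      obtain a where a: "a \<in> D" "a \<in> mspace m" "mdist m x a < e" by (rule dense_inE[OF D x e])
      obtain n where n: "a \<in> A n" using a by (auto simp: D_def)
      have "\<delta>' (h a) = \<delta> a" using hp PD(7) n by metis
      moreover note SD(7)[OF x a(2)] SD(7)[OF a(2) x] SD'(7)[OF hm[OF x] hm[OF a(2)]] SD'(7)[OF hm[OF a(2)] hm[OF x]]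
      ultimately show "\<bar>\<delta>' (h x) - \<delta> x\<bar> \<le> 0 + 2 * e"
        using hd[OF x a(2)] hd[OF a(2) x] mdist_commute[of m a x] a(3) by linarith
    qed simp
    then show "\<delta>' (h x) = \<delta> x" by simp
  next
    fix a assume "a \<in> A0"
    then show "h a = p0 a" using hp[of a 0] s(1) by (simp add: A_def p_def)
  next
    fix n
    have "goal n (A (Suc (2 * n + 1))) (p (Suc (2 * n + 1)))"
      using G[of "2 * n + 1"] by (simp add: G_def sn)
    then show "\<exists>A p. finite_partial_iso m Q \<delta> m' Q' \<delta>' A p \<and> goal n A p \<and> (\<forall>a\<in>A. h a = p a)"
      using fpi hp by blast
  qed
qed

text \<open>The image of a complete space under an isometric embedding is closed.\<close>

lemma surjective_isometry_if_dense_image: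
  assumes h: "isometric_embedding m m' h" and m: "fast_complete m" and D: "dense_in m' D" "D \<subseteq> h ` mspace m"
  shows "surjective_isometry m m' h"
proof -
  have hm: "h x \<in> mspace m'" if "x \<in> mspace m" for x
    using h that by (auto simp: isometric_embedding_def)
  have hd: "mdist m' (h x) (h y) = mdist m x y" if "x \<in> mspace m" "y \<in> mspace m" for x y
    using h that by (auto simp: isometric_embedding_def)
  have "y \<in> h ` mspace m" if y: "y \<in> mspace m'" for y
  proof -
    have "\<exists>x. x \<in> mspace m \<and> mdist m' (h x) y < (1/2) ^ n / 4" for n
    proof -
      obtain a where "a \<in> D" "mdist m' y a < (1/2) ^ n / 4" using dense_inE[OF D(1) y, of "(1/2) ^ n / 4"] by auto
      then show ?thesis using D(2) mdist_commute[of m' y a] by auto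
    qed
    then obtain s where s: "\<And>n. s n \<in> mspace m" "\<And>n. mdist m' (h (s n)) y < (1/2) ^ n / 4" by metis
    have "mdist m (s n) (s (Suc n)) \<le> (1/2) ^ n" for n
    proof -
      have "mdist m' (h (s n)) (h (s (Suc n))) \<le> mdist m' (h (s n)) y + mdist m' y (h (s (Suc n)))"
        using hm s y by (simp add: mdist_triangle)
      then have "mdist m (s n) (s (Suc n)) \<le> (1/2) ^ n / 4 + (1/2) ^ Suc n / 4"
        using hd[OF s(1) s(1)] s(2)[of n] s(2)[of "Suc n"] mdist_commute[of m' y "h (s (Suc n))"] by simp
      also have "\<dots> \<le> (1/2) ^ n" by simp
      finally show ?thesis .
    qed
    then obtain l where l: "l \<in> mspace m" "(\<lambda>n. mdist m (s n) l) \<longlonglongrightarrow> 0"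
      by (rule fast_completeD[OF m s(1)]) blast
    have "(\<lambda>n. mdist m (s n) l + (1/2) ^ n / 4) \<longlonglongrightarrow> 0 + 0 / 4"
      by (intro tendsto_add l tendsto_divide LIMSEQ_power_zero tendsto_const) auto
    moreover have "mdist m' (h l) y \<le> mdist m (s n) l + (1/2) ^ n / 4" for n
    proof -
      have "mdist m' (h l) y \<le> mdist m' (h l) (h (s n)) + mdist m' (h (s n)) y"
        using hm s l y by (simp add: mdist_triangle)
      then show ?thesis using hd[OF l(1) s(1)[of n]] s(2)[of n] mdist_commute[of m l "s n"] by simp
    qed
    ultimately have "mdist m' (h l) y \<le> 0"
      using LIMSEQ_le_const[of _ "0 + 0 / 4" "mdist m' (h l) y"] by auto
    then have "mdist m' (h l) y = 0" using mdist_nonneg by (metis order_antisym)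
    then show ?thesis using hm[OF l(1)] y l(1) by auto
  qed
  then show ?thesis using h hm by (auto simp: surjective_isometry_def)
qed

lemma back_and_forth:
  fixes m :: "'a metric" and m' :: "'b metric"
  assumes S: "retraction_structure m (mspace m) Q \<delta>" and c: "dense_in m (range (c :: nat \<Rightarrow> 'a))" and m: "fast_complete m"
    and S': "retraction_structure m' (mspace m') Q' \<delta>'" and c': "dense_in m' (range (c' :: nat \<Rightarrow> 'b))" and m': "fast_complete m'"
    and forth: "forth m Q \<delta> m' Q' \<delta>'" and forth': "forth m' Q' \<delta>' m Q \<delta>"
    and P: "finite_partial_iso m Q \<delta> m' Q' \<delta>' A0 p0"
  obtains h where "surjective_isometry m m' h"
    "\<And>x. x \<in> mspace m \<Longrightarrow> Q' (h x) = h (Q x)" "\<And>x. x \<in> mspace m \<Longrightarrow> \<delta>' (h x) = \<delta> x"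
    "\<And>a. a \<in> A0 \<Longrightarrow> h a = p0 a"
proof -
  have back': "\<exists>A' p'. finite_partial_iso m Q \<delta> m' Q' \<delta>' A' p' \<and> A \<subseteq> A' \<and> (\<forall>a\<in>A. p' a = p a) \<and> c' n \<in> p' ` A'"
    if A: "finite_partial_iso m Q \<delta> m' Q' \<delta>' A p" for A p n
  proof -
    have inj: "inj_on p A" by (rule finite_partial_iso_inj[OF A])
    have "c' n \<in> mspace m'" using c' by (auto simp: dense_in_def)
    then obtain B i where B: "finite_partial_iso m' Q' \<delta>' m Q \<delta> B i" "p ` A \<subseteq> B" "c' n \<in> B"
      "\<forall>b\<in>p ` A. i b = inv_into A p b"
      using forth' finite_partial_iso_inverse[OF A] unfolding forth_def by meson
    have inji: "inj_on i B" by (rule finite_partial_iso_inj[OF B(1)])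
    have ip: "i (p a) = a" if "a \<in> A" for a using B(4) that inj by simp
    have pi: "inv_into B i (i b) = b" if "b \<in> B" for b using inji that by simp
    show ?thesis
    proof (intro exI conjI ballI)
      show "finite_partial_iso m Q \<delta> m' Q' \<delta>' (i ` B) (inv_into B i)"
        by (rule finite_partial_iso_inverse[OF B(1)])
      show "A \<subseteq> i ` B" using ip B(2) by (metis image_eqI image_subset_iff subsetI)
      show "inv_into B i a = p a" if "a \<in> A" for a
        using pi[of "p a"] ip[OF that] B(2) that by auto
      show "c' n \<in> inv_into B i ` i ` B" using pi[OF B(3)] B(3) by (metis image_eqI)
    qed
  qed
  obtain h where h: "isometric_embedding m m' h"
    "\<And>x. x \<in> mspace m \<Longrightarrow> Q' (h x) = h (Q x)" "\<And>x. x \<in> mspace m \<Longrightarrow> \<delta>' (h x) = \<delta> x"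
    "\<And>a. a \<in> A0 \<Longrightarrow> h a = p0 a"
    "\<And>n. \<exists>A p. finite_partial_iso m Q \<delta> m' Q' \<delta>' A p \<and> c' n \<in> p ` A \<and> (\<forall>a\<in>A. h a = p a)"
  proof (rule generic_embedding[OF S c S' m' forth P, of "\<lambda>n A p. c' n \<in> p ` A"])
    fix n A p assume "finite_partial_iso m Q \<delta> m' Q' \<delta>' A p"
    then show "\<exists>A' p'. finite_partial_iso m Q \<delta> m' Q' \<delta>' A' p' \<and> A \<subseteq> A' \<and> (\<forall>a\<in>A. p' a = p a) \<and> c' n \<in> p' ` A'"
      by (rule back')
  qed (rule that, assumption+)
  have "c' n \<in> h ` mspace m" for n
  proof -
    obtain A p where A: "finite_partial_iso m Q \<delta> m' Q' \<delta>' A p" "c' n \<in> p ` A" "\<forall>a\<in>A. h a = p a"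
      using h(5) by blast
    then obtain a where "a \<in> A" "c' n = h a" by auto
    then show ?thesis using finite_partial_isoD(3)[OF A(1)] by auto
  qed
  then have "surjective_isometry m m' h"
    by (intro surjective_isometry_if_dense_image[OF h(1) m c']) auto
  then show ?thesis using that h by blast
qed

section \<open>The generic retraction\<close>

lemma dist_to_set_le:
  assumes "y \<in> F"
  shows "dist_to_set m x F \<le> mdist m x y"
  unfolding dist_to_set_def using assms by (intro cINF_lower) (auto intro!: bdd_belowI[of _ 0])

lemma le_dist_to_set:
  assumes "F \<noteq> {}" "\<And>y. y \<in> F \<Longrightarrow> c \<le> mdist m x y"
  shows "c \<le> dist_to_set m x F"
  unfolding dist_to_set_def using assms by (intro cINF_greatest) auto

text \<open>The bound \<open>d x (R x) \<le> 2 * d x y\<close> holds for every \<open>y\<close> of the range and passes to the infimum, which is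
taken over a nonempty set as soon as the space has a point.\<close>

lemma retraction_structure_if_lipschitz1_retraction:
  assumes R: "lipschitz1_retraction m F R"
  shows "retraction_structure m (mspace m) R (\<lambda>x. dist_to_set m x F)"
proof -
  have F: "F \<subseteq> mspace m" "R ` mspace m = F" "\<And>x. x \<in> F \<Longrightarrow> R x = x"
    and lip: "\<And>x y. x \<in> mspace m \<Longrightarrow> y \<in> mspace m \<Longrightarrow> mdist m (R x) (R y) \<le> mdist m x y"
    using R unfolding lipschitz1_retraction_def by blast+
  have RF: "R x \<in> F" if "x \<in> mspace m" for x using F(2) that by blast
  have ne: "F \<noteq> {}" if "x \<in> mspace m" for x using RF that by blast
  show ?thesis
    unfolding retraction_structure_def
  proof (intro conjI ballI)
    fix x assume x: "x \<in> mspace m"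
    show Rx: "R x \<in> mspace m" using RF[OF x] F(1) by blast
    have "dist_to_set m (R x) F \<le> 0" using dist_to_set_le[OF RF[OF x], of m "R x"] Rx by simp
    moreover have "0 \<le> dist_to_set m (R x) F" by (rule le_dist_to_set[OF ne[OF x]]) simp
    ultimately show "dist_to_set m (R x) F = 0" by simp
    have "mdist m x (R x) / 2 \<le> dist_to_set m x F"
    proof (rule le_dist_to_set[OF ne[OF x]])
      fix y assume y: "y \<in> F"
      then have ym: "y \<in> mspace m" using F(1) by blast
      have "mdist m x (R x) \<le> mdist m x y + mdist m y (R x)" using x ym Rx by (rule mdist_triangle)
      then show "mdist m x (R x) / 2 \<le> mdist m x y"
        using lip[OF ym x] F(3)[OF y] mdist_commute[of m x y] by simp
    qed
    then show "mdist m x (R x) \<le> 2 * dist_to_set m x F" by simp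
  next
    fix x y assume xy: "x \<in> mspace m" "y \<in> mspace m"
    show "mdist m (R x) (R y) \<le> mdist m x y" by (rule lip[OF xy])
    have "dist_to_set m x F - mdist m x y \<le> dist_to_set m y F"
    proof (rule le_dist_to_set[OF ne[OF xy(1)]])
      fix z assume z: "z \<in> F"
      have "mdist m x z \<le> mdist m x y + mdist m y z" using xy z F(1) by (intro mdist_triangle) auto
      then show "dist_to_set m x F - mdist m x y \<le> mdist m y z" using dist_to_set_le[OF z, of m x] by linarith
    qed
    then show "dist_to_set m x F \<le> dist_to_set m y F + mdist m x y" by simp
  qed simp
qed

text \<open>In a structure with the extension property the abstract function \<open>\<delta>\<close> is the actual distance to the
range, and the distance is attained: the constant function \<open>\<delta> x\<close> on \<open>{x, Q x}\<close> is the type of a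
point of the range. The bound \<open>d x (Q x) \<le> 2 * \<delta> x\<close> is just what makes it a Katetov function.\<close>

lemma distance_to_range:
  assumes S: "retraction_structure U (mspace U) Q \<delta>" and ext: "extension_property U Q \<delta>" and x: "x \<in> mspace U"
  shows "dist_to_set U x (Q ` mspace U) = \<delta> x"
proof (rule antisym)
  note SD = retraction_structureD[OF S]
  have Qx: "Q x \<in> mspace U" by (rule SD(3)[OF x])
  have d0: "0 \<le> \<delta> x" by (rule retraction_structure_nonneg[OF S x])
  have "one_point_type U {x, Q x} Q \<delta> (\<lambda>_. \<delta> x) None 0"
    using x Qx d0 SD(4)[OF x] SD(5)[OF x] mdist_commute[of U x "Q x"]
    by (simp add: one_point_type_def katetov_def)
  moreover have "finite {x, Q x}" "{x, Q x} \<subseteq> mspace U" "Q ` {x, Q x} \<subseteq> {x, Q x}"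
    using x Qx retraction_structure_idem[OF S x] by auto
  ultimately obtain y where y: "y \<in> mspace U" "mdist U y x = \<delta> x" "Q y = y"
    by (rule extension_propertyE[OF ext]) auto
  then have "y \<in> Q ` mspace U" by (metis image_eqI)
  then show "dist_to_set U x (Q ` mspace U) \<le> \<delta> x"
    using dist_to_set_le[of y "Q ` mspace U" U x] mdist_commute[of U x y] y(2) by simp
  show "\<delta> x \<le> dist_to_set U x (Q ` mspace U)"
  proof (rule le_dist_to_set)
    show "Q ` mspace U \<noteq> {}" using x by blast
    fix y assume "y \<in> Q ` mspace U"
    then obtain z where z: "z \<in> mspace U" "y = Q z" by blast
    then show "\<delta> x \<le> mdist U x y" using SD(7)[OF x SD(3)[OF z(1)]] SD(4)[OF z(1)] by simp
  qed
qed

lemma generic_retraction: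
  assumes U: "urysohn_space U"
  obtains F R where "lipschitz1_retraction U F R" "extension_property U R (\<lambda>x. dist_to_set U x F)"
proof -
  obtain Q \<delta> where S: "retraction_structure U (mspace U) Q \<delta>" and ext: "extension_property U Q \<delta>"
    by (rule generic_retraction_structure[OF U])
  note SD = retraction_structureD[OF S]
  let ?F = "Q ` mspace U"
  have "lipschitz1_retraction U ?F Q"
    unfolding lipschitz1_retraction_def using SD(3,6) retraction_structure_idem[OF S] by auto
  moreover have "extension_property U Q (\<lambda>x. dist_to_set U x ?F)"
    unfolding extension_property_def
  proof (intro allI impI, elim conjE)
    fix A f q r
    assume A: "finite A" "A \<subseteq> mspace U" "Q ` A \<subseteq> A" and T: "one_point_type U A Q (\<lambda>x. dist_to_set U x ?F) f q r"
    have "one_point_type U A Q \<delta> f q r"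
      by (rule one_point_type_cong[OF T]) (use A distance_to_range[OF S ext] in auto)
    then obtain x where "x \<in> mspace U" "\<And>a. a \<in> A \<Longrightarrow> mdist U x a = f a" "Q x = image_point q x" "\<delta> x = r"
      using A by (rule extension_propertyE[OF ext]) blast
    then show "\<exists>x\<in>mspace U. (\<forall>a\<in>A. mdist U x a = f a) \<and> Q x = image_point q x \<and> dist_to_set U x ?F = r"
      using distance_to_range[OF S ext] by auto
  qed
  ultimately show ?thesis by (rule that)
qed

text \<open>The extension property yields a point of the range and then a point at distance \<open>1\<close> above it.\<close>

lemma range_proper:
  assumes R: "lipschitz1_retraction U F R" and ext: "extension_property U R (\<lambda>x. dist_to_set U x F)"
  shows "F \<subset> mspace U"
proof -
  let ?\<delta> = "\<lambda>x. dist_to_set U x F"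
  note S = retraction_structure_if_lipschitz1_retraction[OF R]
  have F: "F \<subseteq> mspace U" "\<And>x. x \<in> F \<Longrightarrow> R x = x" using R by (auto simp: lipschitz1_retraction_def)
  have "one_point_type U {} R ?\<delta> f None 0" for f by (simp add: one_point_type_def katetov_def)
  then obtain y where y: "y \<in> mspace U" "R y = y" "?\<delta> y = 0"
    by (rule extension_propertyE[OF ext]) auto
  have "one_point_type U {y} R ?\<delta> (\<lambda>_. 1) (Some y) 1"
    using y by (simp add: one_point_type_def katetov_def)
  then obtain x where x: "x \<in> mspace U" "mdist U x y = 1" "R x = y"
    by (rule extension_propertyE[OF ext]) (use y in auto)
  have "x \<notin> F"
  proof
    assume "x \<in> F"
    then have "x = y" using F(2) x(3) by auto
    then show False using x(1,2) by simp
  qed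
  then show ?thesis using F(1) x(1) by blast
qed

text \<open>Over a finite subset of the range every Katetov function is the type of a point of the range, since
\<open>Q\<close> and \<open>\<delta>\<close> are trivial there. Hence the range has the one-point extension property of the Urysohn
space, and a back-and-forth argument between the two plain metric spaces gives the isometry.\<close>

lemma range_isometric:
  assumes U: "urysohn_space U" and R: "lipschitz1_retraction U F R"
    and ext: "extension_property U R (\<lambda>x. dist_to_set U x F)"
  obtains \<phi> where "surjective_isometry U (submetric U F) \<phi>"
proof -
  let ?\<delta> = "\<lambda>x. dist_to_set U x F" and ?F = "submetric U F"
  note S = retraction_structure_if_lipschitz1_retraction[OF R]
  note SD = retraction_structureD[OF S]
  have F: "F \<subseteq> mspace U" "R ` mspace U = F" "\<And>x. x \<in> F \<Longrightarrow> R x = x"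
    using R by (auto simp: lipschitz1_retraction_def)
  have mF: "mspace ?F = F" using F(1) by auto
  have RF: "R x \<in> F" if "x \<in> mspace U" for x using F(2) that by blast
  have polish: "polish_metric U" using U by (simp add: urysohn_space_def)
  then have complete: "fast_complete U" using fast_complete_if_mcomplete by (auto simp: polish_metric_def)
  obtain x0 where "x0 \<in> mspace U"
    by (rule urysohn_one_point[OF U, of "{}" "\<lambda>_. 0"]) (auto simp: katetov_def)
  then obtain c :: "nat \<Rightarrow> 'a" where c: "dense_in U (range c)"
    using polish_dense_sequence[OF polish] by blast
  have cU: "c i \<in> mspace U" for i using c by (auto simp: dense_in_def)
  have cF: "dense_in ?F (range (\<lambda>i. R (c i)))"
    unfolding dense_in_def mF
  proof (intro conjI ballI allI impI)
    show "range (\<lambda>i. R (c i)) \<subseteq> F" using RF cU by auto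
    fix x and e :: real assume x: "x \<in> F" and e: "e > 0"
    then have xU: "x \<in> mspace U" using F by blast
    obtain a where "a \<in> range c" "mdist U x a < e" by (rule dense_inE[OF c xU e])
    then obtain i where i: "mdist U x (c i) < e" by blast
    have "mdist U (R x) (R (c i)) < e" using SD(6)[OF xU cU[of i]] i by linarith
    then show "\<exists>a\<in>range (\<lambda>i. R (c i)). mdist ?F x a < e" using F(3)[OF x] by auto
  qed
  have completeF: "fast_complete ?F"
    unfolding fast_complete_def mF mdist_submetric
  proof (intro allI impI, elim conjE)
    fix s assume s: "\<forall>n. s n \<in> F" "\<forall>n. mdist U (s n) (s (Suc n)) \<le> (1/2) ^ n"
    have sU: "s n \<in> mspace U" for n using s(1) F(1) by blast
    obtain l where l: "l \<in> mspace U" "(\<lambda>n. mdist U (s n) l) \<longlonglongrightarrow> 0"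
      by (rule fast_completeD[OF complete sU, of id]) (use s in auto)
    have Rl: "R l \<in> mspace U" by (rule SD(3)[OF l(1)])
    have "mdist U (R l) l \<le> mdist U (s n) l + mdist U (s n) l" for n
    proof -
      have "mdist U (R l) l \<le> mdist U (R l) (s n) + mdist U (s n) l" using Rl sU l(1) by (simp add: mdist_triangle)
      moreover have "mdist U (R l) (s n) \<le> mdist U l (s n)" using SD(6)[OF l(1) sU[of n]] F(3) s(1) by simp
      ultimately show ?thesis using mdist_commute[of U l "s n"] by linarith
    qed
    then have "mdist U (R l) l \<le> 0"
      using LIMSEQ_le_const[OF tendsto_add[OF l(2) l(2)], of "mdist U (R l) l"] by simp
    then have "R l = l" using Rl l(1) mdist_nonneg[of U "R l" l] by (metis mdist_zero order_antisym)
    then show "\<exists>l\<in>F. (\<lambda>n. mdist U (s n) l) \<longlonglongrightarrow> 0" using RF[OF l(1)] l by metis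
  qed
  have triv: "retraction_structure m (mspace m) (\<lambda>x. x) (\<lambda>_. 0)" for m :: "'a metric"
    by (simp add: retraction_structure_def)
  have forth1: "forth U (\<lambda>x. x) (\<lambda>_. 0) ?F (\<lambda>x. x) (\<lambda>_. 0)"
  proof (rule forth_if_katetov_realised)
    fix A f assume A: "finite A" "A \<subseteq> mspace ?F" and f: "katetov ?F A f"
    have AF: "A \<subseteq> F" using A(2) mF by simp
    have AU: "A \<subseteq> mspace U" using AF F(1) by blast
    have fU: "katetov U A f" using f by (simp add: katetov_def)
    have "one_point_type U A R ?\<delta> f None 0"
    proof -
      have "?\<delta> a = 0 \<and> R a = a" if "a \<in> A" for a
      proof -
        have "R a = a" "a \<in> mspace U" using F(3) that AF AU by auto
        then show ?thesis using SD(4)[of a] by simp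
      qed
      then show ?thesis using fU katetov_nonneg[OF fU] by (simp add: one_point_type_def)
    qed
    moreover have "R ` A \<subseteq> A" using F(3) AF by auto
    ultimately obtain z where z: "z \<in> mspace U" "\<And>a. a \<in> A \<Longrightarrow> mdist U z a = f a" "R z = z"
      by (rule extension_propertyE[OF ext _ A(1) AU]) auto
    then have "z \<in> F" using RF[OF z(1)] by simp
    then show "\<exists>z\<in>mspace ?F. \<forall>a\<in>A. mdist ?F z a = f a"
      unfolding mF mdist_submetric using z(2) by blast
  qed
  have forth2: "forth ?F (\<lambda>x. x) (\<lambda>_. 0) U (\<lambda>x. x) (\<lambda>_. 0)"
  proof (rule forth_if_katetov_realised)
    fix A f assume "finite A" "A \<subseteq> mspace U" "katetov U A f"
    then show "\<exists>z\<in>mspace U. \<forall>a\<in>A. mdist U z a = f a" by (rule urysohn_one_point[OF U]) blast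
  qed
  show ?thesis
    by (rule back_and_forth[OF triv c complete triv cF completeF forth1 forth2 finite_partial_iso_empty[where p = undefined]]) (rule that)
qed

lemma universal_if_extension_property:
  assumes U: "urysohn_space U" and R: "lipschitz1_retraction U F R"
    and ext: "extension_property U R (\<lambda>x. dist_to_set U x F)"
  shows "universal_retraction U F R"
  unfolding universal_retraction_def
proof (intro allI impI, elim conjE)
  fix X :: "real metric" and FX Q assume X: "polish_metric X" and Q: "lipschitz1_retraction X FX Q"
  show "\<exists>h. retraction_embedding X FX Q U F R h"
  proof (cases "mspace X = {}")
    case True
    then show ?thesis by (simp add: retraction_embedding_def isometric_embedding_def)
  next
    case False
    obtain c :: "nat \<Rightarrow> real" where c: "dense_in X (range c)" by (rule polish_dense_sequence[OF X False])
    have complete: "fast_complete U"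
      using U fast_complete_if_mcomplete by (auto simp: polish_metric_def urysohn_space_def)
    note S = retraction_structure_if_lipschitz1_retraction
    obtain h where "isometric_embedding X U h" "\<And>x. x \<in> mspace X \<Longrightarrow> R (h x) = h (Q x)"
      "\<And>x. x \<in> mspace X \<Longrightarrow> dist_to_set U (h x) F = dist_to_set X x FX"
      by (rule generic_embedding[OF S[OF Q] c S[OF R] complete
            forth_if_extension_property[OF S[OF Q] S[OF R] ext] finite_partial_iso_empty[where p = undefined],
            of "\<lambda>_ _ _. True"]) blast+
    then show ?thesis unfolding retraction_embedding_def by auto
  qed
qed

lemma ultrahomogeneous_if_extension_property:
  assumes U: "urysohn_space U" and R: "lipschitz1_retraction U F R"
    and ext: "extension_property U R (\<lambda>x. dist_to_set U x F)"
  shows "ultrahomogeneous_retraction U F R"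
  unfolding ultrahomogeneous_retraction_def
proof (intro allI impI, elim conjE)
  fix A1 A2 f
  let ?\<delta> = "\<lambda>x. dist_to_set U x F"
  assume A: "finite A1" "A1 \<subseteq> mspace U" "A2 \<subseteq> mspace U"
    and f: "surjective_isometry (submetric U A1) (submetric U A2) f"
    and comm: "\<forall>x\<in>A1. R x \<in> A1 \<and> f (R x) = R (f x) \<and> ?\<delta> x = ?\<delta> (f x)"
  note S = retraction_structure_if_lipschitz1_retraction[OF R]
  have polish: "polish_metric U" using U by (simp add: urysohn_space_def)
  then have complete: "fast_complete U" using fast_complete_if_mcomplete by (auto simp: polish_metric_def)
  obtain x0 where "x0 \<in> mspace U"
    by (rule urysohn_one_point[OF U, of "{}" "\<lambda>_. 0"]) (auto simp: katetov_def)
  then obtain c :: "nat \<Rightarrow> 'a" where c: "dense_in U (range c)"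
    using polish_dense_sequence[OF polish] by blast
  have P: "finite_partial_iso U R ?\<delta> U R ?\<delta> A1 f"
    using A f comm unfolding finite_partial_iso_def surjective_isometry_def isometric_embedding_def
    by (auto simp: Int_absorb2)
  note forth = forth_if_extension_property[OF S S ext]
  obtain g where "surjective_isometry U U g" "\<And>x. x \<in> mspace U \<Longrightarrow> R (g x) = g (R x)"
    "\<And>x. x \<in> mspace U \<Longrightarrow> ?\<delta> (g x) = ?\<delta> x" "\<And>a. a \<in> A1 \<Longrightarrow> g a = f a"
    by (rule back_and_forth[OF S c complete S c complete forth forth P]) blast
  then show "\<exists>g. retraction_isomorphism U F R U F R g \<and> (\<forall>x\<in>A1. g x = f x)"
    unfolding retraction_isomorphism_def retraction_embedding_def surjective_isometry_def
    by (intro exI[of _ g]) auto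
qed

text \<open>Universality embeds the whole source; ultrahomogeneity then moves the embedding by an automorphism
so that it agrees with the given finite partial isomorphism. Uniqueness thus needs no analysis of
types in the second retraction.\<close>

lemma forth_if_universal_ultrahomogeneous:
  fixes m :: "'b metric"
  assumes R: "lipschitz1_retraction U F R" and hom: "ultrahomogeneous_retraction U F R"
    and univ: "universal_retraction U F R"
    and m: "polish_metric m" and Q: "lipschitz1_retraction m E Q"
  shows "forth m Q (\<lambda>x. dist_to_set m x E) U R (\<lambda>x. dist_to_set U x F)"
  unfolding forth_def
proof (intro allI impI, elim conjE)
  let ?\<delta> = "\<lambda>x. dist_to_set m x E" and ?\<delta>' = "\<lambda>x. dist_to_set U x F"
  fix A p x assume P: "finite_partial_iso m Q ?\<delta> U R ?\<delta>' A p" and x: "x \<in> mspace m"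
  note S = retraction_structure_if_lipschitz1_retraction[OF Q]
  note PD = finite_partial_isoD[OF P]
  obtain h where h: "retraction_embedding m E Q U F R h"
    using universal_retraction_any_type[OF univ m Q] by blast
  have hU: "h y \<in> mspace U" if "y \<in> mspace m" for y
    using h that by (auto simp: retraction_embedding_def isometric_embedding_def)
  have hd: "mdist U (h y) (h z) = mdist m y z" if "y \<in> mspace m" "z \<in> mspace m" for y z
    using h that by (auto simp: retraction_embedding_def isometric_embedding_def)
  have hR: "R (h y) = h (Q y)" "?\<delta>' (h y) = ?\<delta> y" if "y \<in> mspace m" for y
    using h that by (auto simp: retraction_embedding_def)
  have inj: "inj_on h A"
  proof (rule inj_onI)
    fix a b assume ab: "a \<in> A" "b \<in> A" "h a = h b"
    then have "mdist m a b = 0" using hd[of a b] hU[of b] PD(3) by simp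
    then show "a = b" using ab PD(3) by simp
  qed
  \<comment> \<open>The partial isomorphism from the embedded copy of \<open>A\<close> to the image of \<open>p\<close>.\<close>
  define f where "f = (\<lambda>y. p (inv_into A h y))"
  have f: "f (h a) = p a" if "a \<in> A" for a using inj that by (simp add: f_def)
  have "h ` A \<subseteq> mspace U" "p ` A \<subseteq> mspace U" using hU PD(3,5) by auto
  moreover have "surjective_isometry (submetric U (h ` A)) (submetric U (p ` A)) f"
    using calculation PD(3,8) hd
    unfolding surjective_isometry_def isometric_embedding_def
    by (auto simp: Int_absorb2 f image_image)
  moreover have "\<forall>y\<in>h ` A. R y \<in> h ` A \<and> f (R y) = R (f y) \<and> ?\<delta>' y = ?\<delta>' (f y)"
    using PD(3,4,6,7) hR by (auto simp: f)
  ultimately obtain g where g: "retraction_isomorphism U F R U F R g" "\<forall>y\<in>h ` A. g y = f y"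
    using hom[unfolded ultrahomogeneous_retraction_def, rule_format, of "h ` A" "p ` A" f] PD(1) by blast
  have gU: "g y \<in> mspace U" if "y \<in> mspace U" for y
    using g(1) that by (auto simp: retraction_isomorphism_def retraction_embedding_def isometric_embedding_def)
  have gd: "mdist U (g y) (g z) = mdist U y z" if "y \<in> mspace U" "z \<in> mspace U" for y z
    using g(1) that by (auto simp: retraction_isomorphism_def retraction_embedding_def isometric_embedding_def)
  have gR: "R (g y) = g (R y)" "?\<delta>' (g y) = ?\<delta>' y" if "y \<in> mspace U" for y
    using g(1) that by (auto simp: retraction_isomorphism_def retraction_embedding_def)
  have Qx: "Q x \<in> mspace m" "Q (Q x) = Q x"
    using retraction_structureD(3)[OF S x] retraction_structure_idem[OF S x] by auto
  let ?A = "insert x (insert (Q x) A)" and ?p = "\<lambda>a. g (h a)"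
  have Am: "a \<in> mspace m" if "a \<in> ?A" for a using that x Qx PD(3) by auto
  have "finite_partial_iso m Q ?\<delta> U R ?\<delta>' ?A ?p"
    unfolding finite_partial_iso_def
  proof (intro conjI ballI)
    show "finite ?A" using PD(1) by simp
    show "?A \<subseteq> mspace m" using Am by blast
    fix a assume a: "a \<in> ?A"
    show "Q a \<in> ?A" using a Qx(2) PD(4) by auto
    show "?p a \<in> mspace U" "?p (Q a) = R (?p a)" "?\<delta>' (?p a) = ?\<delta> a"
      using Am[OF a] hU gU hR gR by auto
    fix b assume b: "b \<in> ?A"
    show "mdist U (?p a) (?p b) = mdist m a b" using Am[OF a] Am[OF b] hU hd gd by simp
  qed
  moreover have "?p a = p a" if "a \<in> A" for a using g(2) f that by simp
  ultimately show "\<exists>A' p'. finite_partial_iso m Q ?\<delta> U R ?\<delta>' A' p' \<and> A \<subseteq> A' \<and> x \<in> A' \<and> (\<forall>a\<in>A. p' a = p a)"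
    by (intro exI[of _ ?A] exI[of _ ?p]) auto
qed

theorem theorem2p8:
  fixes U :: "'a metric"
  assumes "urysohn_space U"
  shows "\<exists>F R.
    lipschitz1_retraction U F R \<and>
    F \<subset> mspace U \<and>
    (\<exists>\<phi>. surjective_isometry U (submetric U F) \<phi>) \<and>
    ultrahomogeneous_retraction U F R \<and>
    universal_retraction U F R \<and>
    (\<forall>F' R'.
       lipschitz1_retraction U F' R' \<and>
       ultrahomogeneous_retraction U F' R' \<and>
       universal_retraction U F' R' \<longrightarrow>
       (\<exists>h. retraction_isomorphism U F R U F' R' h))"
proof -
  note U = assms
  obtain F R where R: "lipschitz1_retraction U F R" and ext: "extension_property U R (\<lambda>x. dist_to_set U x F)"
    by (rule generic_retraction[OF U])
  note S = retraction_structure_if_lipschitz1_retraction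
  have polish: "polish_metric U" using U by (simp add: urysohn_space_def)
  then have complete: "fast_complete U" using fast_complete_if_mcomplete by (auto simp: polish_metric_def)
  have proper: "F \<subset> mspace U" by (rule range_proper[OF R ext])
  then obtain c :: "nat \<Rightarrow> 'a" where c: "dense_in U (range c)"
    using polish_dense_sequence[OF polish] by blast
  have "\<exists>h. retraction_isomorphism U F R U F' R' h"
    if R': "lipschitz1_retraction U F' R'" and hom: "ultrahomogeneous_retraction U F' R'"
      and univ: "universal_retraction U F' R'" for F' R'
  proof -
    obtain h where "surjective_isometry U U h" "\<And>x. x \<in> mspace U \<Longrightarrow> R' (h x) = h (R x)"
      "\<And>x. x \<in> mspace U \<Longrightarrow> dist_to_set U (h x) F' = dist_to_set U x F"
      by (rule back_and_forth[OF S[OF R] c complete S[OF R'] c complete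
            forth_if_universal_ultrahomogeneous[OF R' hom univ polish R]
            forth_if_extension_property[OF S[OF R'] S[OF R] ext] finite_partial_iso_empty[where p = undefined]]) blast
    then show ?thesis
      unfolding retraction_isomorphism_def retraction_embedding_def surjective_isometry_def
      by (intro exI[of _ h]) auto
  qed
  moreover have "\<exists>\<phi>. surjective_isometry U (submetric U F) \<phi>"
    by (rule range_isometric[OF U R ext]) blast
  ultimately show ?thesis
    using R proper ultrahomogeneous_if_extension_property[OF U R ext] universal_if_extension_property[OF U R ext]
    by blast
qed

end
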